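(* For $k=(k_1,k_2)\in\mathbb{Z}^2$ and $a\in\mathfrak{A}(\mathbb{R}^2)$ define $$h_k(a)=\iint e^{2\pi(\alpha_kx_1+\beta_kx_2)}a(x_1,x_2)\,dx_1dx_2,\qquad \alpha_k:=\alpha+2\beta^{-1}k_1,\quad \beta_k:=\beta+2\alpha^{-1}k_2.$$ (i) The linear functional $h_k$ on the left $U_q(gl_2(\mathbb{R}))$-module $\ast$-algebra $\mathfrak{A}(\mathbb{R}^2)$ is covariant with respect to the character $\chi$ of $U_q(gl_2)$ determined by $\chi(K_1)=\chi(K_2)=q^{1/2}$, $\chi(E)=\chi(F)=0$; that is, $h_k(f\triangleright a)=\chi(f)h_k(a)$ for all $f\in U_q(gl_2)$, $a\in\mathfrak{A}(\mathbb{R}^2)$. (ii) For $s,t\in\mathbb{R}$ and $a\in\mathfrak{A}(\mathbb{R}^2)$, $$h_k\big(a(x_1+\beta s,x_2+\alpha t)\big)=e^{-2\pi\gamma(s+t)-4\pi(k_1s+k_2t)}h_k(a).$$ (iii) $h_k$ is continuous on the Fréchet space $\mathfrak{A}(\mathbb{R}^2)[\tau]$. More precisely, for any $\varepsilon=(\varepsilon_1,\varepsilon_2)$ with $\varepsilon_1>0$, $\varepsilon_2>0$, $$|h_k(a)|\le\frac{1}{2\pi\sqrt{\varepsilon_1\varepsilon_2}}\,\big\|S(e^{2\pi\varepsilon\mathcal{Q}})\,e^{2\pi(\alpha_k\mathcal{Q}_1+\beta_k\mathcal{Q}_2)}a\big\|,\qquad a\in\mathfrak{A}(\mathbb{R}^2),$$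 where $\|\cdot\|$ is the norm of $L^2(\mathbb{R}^2)$.
   Context: Parameters: $q\neq\pm1$ is a complex number of modulus one, $\gamma\in\mathbb{R}$ is fixed with $q=e^{2\pi i\gamma}$, $q^{r}:=e^{2\pi i\gamma r}$ for rational $r$, $\alpha,\beta\in\mathbb{R}$ satisfy $\alpha\beta=\gamma$, and $\lambda:=q-q^{-1}$. The Hopf algebra $U_q(gl_2)$ is the complex unital algebra with generators $E,F,K_1^{\pm1},K_2^{\pm1}$ and relations $K_1K_2=K_2K_1$, $K_jK_j^{-1}=K_j^{-1}K_j=1$, $K_1EK_1^{-1}=q^{1/2}E$, $K_2EK_2^{-1}=q^{-1/2}E$, $K_1FK_1^{-1}=q^{-1/2}F$, $K_2FK_2^{-1}=q^{1/2}F$, $EF-FE=\lambda^{-1}(K^2-K^{-2})$, $K:=K_1K_2^{-1}$; with $\Delta(K_j)=K_j\otimes K_j$, $\Delta(E)=E\otimes K+K^{-1}\otimes E$, $\Delta(F)=F\otimes K+K^{-1}\otimes F$. With the involution $E^\ast=-qE$, $F^\ast=-q^{-1}F$, $K_j^\ast=K_j$ it is the Hopf $\ast$-algebra $U_q(gl_2(\mathbb{R}))$. $\mathfrak{A}(\mathbb{R}^2)$ is the space of functions $a(x_1,x_2)$ on $\mathbb{R}^2$ that extend to entire functions on $\mathbb{C}^2$ (same symbol) with $\sup_{|y_1|<\nu_1,|y_2|<\nu_2}\iint|a(x_1+iy_1,x_2+iy_2)|^2e^{4\pi(\mu_1|x_1|+\mu_2|x_2|)}dx_1dx_2<\infty$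 for all $\mu_1,\mu_2,\nu_1,\nu_2>0$. $U_q(gl_2)$ acts on it by $(E\triangleright a)(x_1,x_2)=\lambda^{-1}e^{2\pi(\beta x_2-\alpha x_1)}(a(x_1+\beta i,x_2)-a(x_1-\beta i,x_2))$, $(F\triangleright a)(x_1,x_2)=\lambda^{-1}e^{2\pi(\alpha x_1-\beta x_2)}(a(x_1,x_2+\alpha i)-a(x_1,x_2-\alpha i))$, $(K_1\triangleright a)(x_1,x_2)=a(x_1-\tfrac{\beta}{2}i,x_2)$, $(K_2\triangleright a)(x_1,x_2)=a(x_1,x_2-\tfrac{\alpha}{2}i)$. (With a suitable product and involution $\mathfrak{A}(\mathbb{R}^2)$ is a left $U_q(gl_2(\mathbb{R}))$-module $\ast$-algebra; only the action is needed here.) On $L^2(\mathbb{R}^2)$, $\mathcal{Q}_j$ is multiplication by $x_j$ and $\mathcal{P}_j=\frac{1}{2\pi i}\frac{\partial}{\partial x_j}$. For $\varepsilon\in\mathbb{R}^2$, $S(e^{2\pi\varepsilon\mathcal{Q}})$ is the operator of multiplication by $(e^{2\pi\varepsilon_1x_1}+e^{-2\pi\varepsilon_1x_1})(e^{2\pi\varepsilon_2x_2}+e^{-2\pi\varepsilon_2x_2})$. $\tau$ is the locally convex topology on $\mathfrak{A}(\mathbb{R}^2)$ generated by the norms $a\mapsto\|e^{2\pi(c_1\mathcal{Q}_1+c_2\mathcal{Q}_2)}e^{2\pi(d_1\mathcal{P}_1+d_2\mathcal{P}_2)}a\|$, $c,d\in\mathbb{R}^2$, where $(e^{2\pi(d_1\mathcal{P}_1+d_2\mathcal{P}_2)}a)(x_1,x_2)=a(x_1-id_1,x_2-id_2)$.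 *)

theory Defs
  imports
    "HOL-Analysis.Analysis"
    "HOL-Algebra.QuotRing"
    "HOL-Algebra.Algebraic_Closure_Type"
    "HOL-Library.Poly_Mapping"
begin

definition qpow :: "real \<Rightarrow> real \<Rightarrow> complex" where
  "qpow \<gamma> r = exp (2 * complex_of_real pi * \<i> * complex_of_real (\<gamma> * r))"

abbreviation lam :: "real \<Rightarrow> complex" where
  "lam \<gamma> \<equiv> qpow \<gamma> 1 - inverse (qpow \<gamma> 1)"

datatype uq_gen = GenE | GenF | GenK1 | GenK1inv | GenK2 | GenK2inv

text \<open>The free monoid on the generators is written additively, so that the monoid algebra
  \<open>uq_word \<Rightarrow>\<^sub>0 complex\<close> is the free complex algebra on them.\<close>

datatype uq_word = Word (letters: "uq_gen list")

instantiation uq_word :: monoid_add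
begin
definition "0 = Word []"
definition "u + v = Word (letters u @ letters v)"
instance
  by standard (auto simp: zero_uq_word_def plus_uq_word_def)
end

type_synonym uq_free = "uq_word \<Rightarrow>\<^sub>0 complex"

definition gen :: "uq_gen \<Rightarrow> uq_free" where
  "gen g = Poly_Mapping.single (Word [g]) 1"

definition scal :: "complex \<Rightarrow> uq_free" where
  "scal c = Poly_Mapping.single 0 c"

definition uq_relators :: "real \<Rightarrow> uq_free set" where
  "uq_relators \<gamma> =
    {gen GenK1 * gen GenK2 - gen GenK2 * gen GenK1,
     gen GenK1 * gen GenK1inv - 1, gen GenK1inv * gen GenK1 - 1,
     gen GenK2 * gen GenK2inv - 1, gen GenK2inv * gen GenK2 - 1,
     gen GenK1 * gen GenE * gen GenK1inv - scal (qpow \<gamma> (1/2)) * gen GenE,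
     gen GenK2 * gen GenE * gen GenK2inv - scal (qpow \<gamma> (-1/2)) * gen GenE,
     gen GenK1 * gen GenF * gen GenK1inv - scal (qpow \<gamma> (-1/2)) * gen GenF,
     gen GenK2 * gen GenF * gen GenK2inv - scal (qpow \<gamma> (1/2)) * gen GenF,
     gen GenE * gen GenF - gen GenF * gen GenE
       - scal (inverse (lam \<gamma>)) * ((gen GenK1 * gen GenK2inv)^2 - (gen GenK2 * gen GenK1inv)^2)}"

abbreviation uq_free_ring :: "uq_free ring" where
  "uq_free_ring \<equiv> ring_of_type_algebra"

definition uq_ideal :: "real \<Rightarrow> uq_free set" where
  "uq_ideal \<gamma> = Idl\<^bsub>uq_free_ring\<^esub> (uq_relators \<gamma>)"

definition Uq :: "real \<Rightarrow> uq_free set ring" where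
  "Uq \<gamma> = uq_free_ring Quot uq_ideal \<gamma>"

definition uq_class :: "real \<Rightarrow> uq_free \<Rightarrow> uq_free set" where
  "uq_class \<gamma> p = uq_ideal \<gamma> +>\<^bsub>uq_free_ring\<^esub> p"

definition uq_character :: "real \<Rightarrow> (uq_free set \<Rightarrow> complex) \<Rightarrow> bool" where
  "uq_character \<gamma> chi \<longleftrightarrow>
     chi \<in> ring_hom (Uq \<gamma>) ring_of_type_algebra \<and> (\<forall>c. chi (uq_class \<gamma> (scal c)) = c)"

definition chi_values :: "real \<Rightarrow> (uq_free set \<Rightarrow> complex) \<Rightarrow> bool" where
  "chi_values \<gamma> chi \<longleftrightarrow>
     chi (uq_class \<gamma> (gen GenK1)) = qpow \<gamma> (1/2) \<and> chi (uq_class \<gamma> (gen GenK2)) = qpow \<gamma> (1/2) \<and>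
     chi (uq_class \<gamma> (gen GenE)) = 0 \<and> chi (uq_class \<gamma> (gen GenF)) = 0"

text \<open>A function on \<open>\<real>\<^sup>2\<close> with an entire extension is represented by that (unique)
  extension.\<close>

type_synonym fun2 = "complex \<times> complex \<Rightarrow> complex"

definition entire2 :: "fun2 \<Rightarrow> bool" where
  "entire2 a \<longleftrightarrow>
     (\<forall>z. \<exists>c1 c2. (a has_derivative (\<lambda>(h1, h2). c1 * h1 + c2 * h2)) (at z))"

definition space_A :: "fun2 set" where
  "space_A = {a. entire2 a \<and>
     (\<forall>\<mu>1>0. \<forall>\<mu>2>0. \<forall>\<nu>1>0. \<forall>\<nu>2>0.
        (SUP (y1, y2) \<in> {-\<nu>1<..<\<nu>1} \<times> {-\<nu>2<..<\<nu>2 :: real}.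
           \<integral>\<^sup>+ (x1, x2). ennreal ((cmod (a (Complex x1 y1, Complex x2 y2)))\<^sup>2
               * exp (4 * pi * (\<mu>1 * \<bar>x1\<bar> + \<mu>2 * \<bar>x2\<bar>))) \<partial>(lborel :: (real \<times> real) measure))
        < \<infinity>)}"

fun gen_act :: "real \<Rightarrow> real \<Rightarrow> real \<Rightarrow> uq_gen \<Rightarrow> fun2 \<Rightarrow> fun2" where
  "gen_act \<gamma> \<alpha> \<beta> GenE a = (\<lambda>(z1 :: complex, z2 :: complex). inverse (lam \<gamma>) * exp (2 * pi * (\<beta> * z2 - \<alpha> * z1))
      * (a (z1 + \<beta> * \<i>, z2) - a (z1 - \<beta> * \<i>, z2)))"
| "gen_act \<gamma> \<alpha> \<beta> GenF a = (\<lambda>(z1 :: complex, z2 :: complex). inverse (lam \<gamma>) * exp (2 * pi * (\<alpha> * z1 - \<beta> * z2))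
      * (a (z1, z2 + \<alpha> * \<i>) - a (z1, z2 - \<alpha> * \<i>)))"
| "gen_act \<gamma> \<alpha> \<beta> GenK1 a = (\<lambda>(z1 :: complex, z2 :: complex). a (z1 - complex_of_real \<beta> / 2 * \<i>, z2))"
| "gen_act \<gamma> \<alpha> \<beta> GenK1inv a = (\<lambda>(z1 :: complex, z2 :: complex). a (z1 + complex_of_real \<beta> / 2 * \<i>, z2))"
| "gen_act \<gamma> \<alpha> \<beta> GenK2 a = (\<lambda>(z1 :: complex, z2 :: complex). a (z1, z2 - complex_of_real \<alpha> / 2 * \<i>))"
| "gen_act \<gamma> \<alpha> \<beta> GenK2inv a = (\<lambda>(z1 :: complex, z2 :: complex). a (z1, z2 + complex_of_real \<alpha> / 2 * \<i>))"

definition word_act :: "real \<Rightarrow> real \<Rightarrow> real \<Rightarrow> uq_word \<Rightarrow> fun2 \<Rightarrow> fun2" where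
  "word_act \<gamma> \<alpha> \<beta> w a = foldr (gen_act \<gamma> \<alpha> \<beta>) (letters w) a"

definition free_act :: "real \<Rightarrow> real \<Rightarrow> real \<Rightarrow> uq_free \<Rightarrow> fun2 \<Rightarrow> fun2" where
  "free_act \<gamma> \<alpha> \<beta> p a =
     (\<lambda>z. \<Sum>w\<in>Poly_Mapping.keys p. Poly_Mapping.lookup p w * word_act \<gamma> \<alpha> \<beta> w a z)"

text \<open>The choice of the representative is irrelevant: see \<open>uq_act_class\<close> below.\<close>

definition uq_act :: "real \<Rightarrow> real \<Rightarrow> real \<Rightarrow> uq_free set \<Rightarrow> fun2 \<Rightarrow> fun2" where
  "uq_act \<gamma> \<alpha> \<beta> f a = free_act \<gamma> \<alpha> \<beta> (SOME p. p \<in> f) a"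

lemma free_act_superset:
  assumes "finite S" "Poly_Mapping.keys p \<subseteq> S"
  shows "free_act \<gamma> \<alpha> \<beta> p a z = (\<Sum>w\<in>S. Poly_Mapping.lookup p w * word_act \<gamma> \<alpha> \<beta> w a z)"
  unfolding free_act_def
  by (rule sum.mono_neutral_left) (use assms in \<open>auto simp: in_keys_iff\<close>)

lemma free_act_add:
  "free_act \<gamma> \<alpha> \<beta> (p + r) a z = free_act \<gamma> \<alpha> \<beta> p a z + free_act \<gamma> \<alpha> \<beta> r a z"
proof -
  let ?S = "Poly_Mapping.keys p \<union> Poly_Mapping.keys r"
  have "Poly_Mapping.keys (p + r) \<subseteq> ?S" by (rule Poly_Mapping.keys_add)
  then show ?thesis
    by (simp add: free_act_superset[of ?S] lookup_add algebra_simps sum.distrib)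
qed

lemma free_act_zero [simp]: "free_act \<gamma> \<alpha> \<beta> 0 a z = 0"
  by (simp add: free_act_def)

lemma free_act_uminus: "free_act \<gamma> \<alpha> \<beta> (- p) a z = - free_act \<gamma> \<alpha> \<beta> p a z"
  using free_act_add[of \<gamma> \<alpha> \<beta> "- p" p a z] by (simp add: eq_neg_iff_add_eq_0)

lemma free_act_diff:
  "free_act \<gamma> \<alpha> \<beta> (p - r) a z = free_act \<gamma> \<alpha> \<beta> p a z - free_act \<gamma> \<alpha> \<beta> r a z"
  using free_act_add[of \<gamma> \<alpha> \<beta> p "- r" a z] by (simp add: free_act_uminus)

lemma free_act_single:
  "free_act \<gamma> \<alpha> \<beta> (Poly_Mapping.single w c) a z = c * word_act \<gamma> \<alpha> \<beta> w a z"
  by (simp add: free_act_def)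

lemma gen_act_lin:
  "gen_act \<gamma> \<alpha> \<beta> g (\<lambda>z. c * a z + d * b z)
   = (\<lambda>z. c * gen_act \<gamma> \<alpha> \<beta> g a z + d * gen_act \<gamma> \<alpha> \<beta> g b z)"
  by (cases g) (auto simp: fun_eq_iff algebra_simps)

lemma foldr_gen_act_lin:
  "foldr (gen_act \<gamma> \<alpha> \<beta>) gs (\<lambda>z. c * a z + d * b z)
   = (\<lambda>z. c * foldr (gen_act \<gamma> \<alpha> \<beta>) gs a z + d * foldr (gen_act \<gamma> \<alpha> \<beta>) gs b z)"
  by (induction gs) (auto simp: gen_act_lin)

lemma word_act_lin:
  "word_act \<gamma> \<alpha> \<beta> w (\<lambda>z. c * a z + d * b z)
   = (\<lambda>z. c * word_act \<gamma> \<alpha> \<beta> w a z + d * word_act \<gamma> \<alpha> \<beta> w b z)"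
  unfolding word_act_def by (rule foldr_gen_act_lin)

lemma free_act_lin:
  "free_act \<gamma> \<alpha> \<beta> p (\<lambda>z. c * a z + d * b z)
   = (\<lambda>z. c * free_act \<gamma> \<alpha> \<beta> p a z + d * free_act \<gamma> \<alpha> \<beta> p b z)"
  by (simp add: free_act_def word_act_lin algebra_simps sum.distrib sum_distrib_left)

lemma uq_free_induct [case_names zero add single]:
  fixes p :: uq_free
  assumes "P 0" "\<And>p r. P p \<Longrightarrow> P r \<Longrightarrow> P (p + r)" "\<And>w c. P (Poly_Mapping.single w c)"
  shows "P p"
proof (induction p rule: update_induct)
  case const
  show ?case by (rule assms)
next
  case (update p w c)
  have "Poly_Mapping.update w c p = p + Poly_Mapping.single w c"
    using update by (intro poly_mapping_eqI)
      (auto simp: lookup_update lookup_add lookup_single when_def in_keys_iff)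
  then show ?case using update assms by metis
qed

lemma free_act_mult:
  "free_act \<gamma> \<alpha> \<beta> (p * r) a = free_act \<gamma> \<alpha> \<beta> p (free_act \<gamma> \<alpha> \<beta> r a)"
proof (induction p rule: uq_free_induct)
  case (single w c)
  show ?case
  proof (induction r rule: uq_free_induct)
    case zero
    have "free_act \<gamma> \<alpha> \<beta> 0 a = (\<lambda>z. 0 * a z + 0 * a z)"
      by (simp add: fun_eq_iff)
    then show ?case by (simp only: free_act_lin) (simp add: fun_eq_iff)
  next
    case (add r s)
    have "free_act \<gamma> \<alpha> \<beta> (r + s) a
        = (\<lambda>z. 1 * free_act \<gamma> \<alpha> \<beta> r a z + 1 * free_act \<gamma> \<alpha> \<beta> s a z)"
      by (simp add: free_act_add fun_eq_iff)
    then show ?case using add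
      by (simp only: free_act_lin) (simp add: distrib_left free_act_add fun_eq_iff)
  next
    case (single v d)
    have "free_act \<gamma> \<alpha> \<beta> (Poly_Mapping.single v d) a
        = (\<lambda>z. d * word_act \<gamma> \<alpha> \<beta> v a z + 0 * word_act \<gamma> \<alpha> \<beta> v a z)"
      by (simp add: free_act_single fun_eq_iff)
    then show ?case
      by (simp only: free_act_lin)
        (simp add: mult_single free_act_single fun_eq_iff word_act_def plus_uq_word_def)
  qed
qed (auto simp: free_act_add fun_eq_iff distrib_right)

lemma free_act_one: "free_act \<gamma> \<alpha> \<beta> 1 a = a"
  by (simp add: single_one[symmetric] free_act_single fun_eq_iff word_act_def zero_uq_word_def
      del: single_one)

lemma free_act_gen: "free_act \<gamma> \<alpha> \<beta> (gen g) a = gen_act \<gamma> \<alpha> \<beta> g a"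
  by (simp add: gen_def free_act_single fun_eq_iff word_act_def)

lemma free_act_scal: "free_act \<gamma> \<alpha> \<beta> (scal c) a = (\<lambda>z. c * a z)"
  by (simp add: scal_def free_act_single fun_eq_iff word_act_def zero_uq_word_def)

lemma qpow_add: "qpow \<gamma> (r + s) = qpow \<gamma> r * qpow \<gamma> s"
  by (simp add: qpow_def exp_add[symmetric] algebra_simps)

lemma qpow_minus: "qpow \<gamma> (- r) = inverse (qpow \<gamma> r)"
  by (simp add: qpow_def exp_minus)

lemma qpow_nonzero [simp]: "qpow \<gamma> r \<noteq> 0"
  by (simp add: qpow_def)

lemma lam_nonzero:
  assumes "qpow \<gamma> 1 \<noteq> 1" "qpow \<gamma> 1 \<noteq> -1"
  shows "lam \<gamma> \<noteq> 0"
proof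
  assume "lam \<gamma> = 0"
  then have "qpow \<gamma> 1 * qpow \<gamma> 1 = 1" by (simp add: field_simps)
  then have "(qpow \<gamma> 1 - 1) * (qpow \<gamma> 1 + 1) = 0" by (simp add: algebra_simps)
  then show False using assms by (simp add: eq_neg_iff_add_eq_0)
qed

lemma free_act_relator:
  assumes q: "qpow \<gamma> 1 \<noteq> 1" "qpow \<gamma> 1 \<noteq> -1" and ab: "\<alpha> * \<beta> = \<gamma>"
    and p: "p \<in> uq_relators \<gamma>"
  shows "free_act \<gamma> \<alpha> \<beta> p a z = 0"
proof -
  obtain z1 z2 where z: "z = (z1, z2)" by (cases z)
  define e where "e = exp (2 * pi * (\<beta> * z2 - \<alpha> * z1) :: complex)"
  define f where "f = exp (2 * pi * (\<alpha> * z1 - \<beta> * z2) :: complex)"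
  have ef: "e * f = 1" by (simp add: e_def f_def exp_add[symmetric] algebra_simps)
  have ab': "complex_of_real \<gamma> = complex_of_real \<alpha> * complex_of_real \<beta>"
    using ab by (metis of_real_mult)
  define Q where "Q = qpow \<gamma> 1"
  define h where "h = qpow \<gamma> (1/2)"
  have hi: "qpow \<gamma> (-1/2) = inverse h" using qpow_minus[of \<gamma> "1/2"] by (simp add: h_def)
  have shifts:
    "exp (2 * pi * (\<beta> * z2 - \<alpha> * (z1 - complex_of_real \<beta> / 2 * \<i>)) :: complex) = h * e"
    "exp (2 * pi * (\<beta> * (z2 - complex_of_real \<alpha> / 2 * \<i>) - \<alpha> * z1) :: complex) = inverse h * e"
    "exp (2 * pi * (\<alpha> * (z1 - complex_of_real \<beta> / 2 * \<i>) - \<beta> * z2) :: complex) = inverse h * f"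
    "exp (2 * pi * (\<alpha> * z1 - \<beta> * (z2 - complex_of_real \<alpha> / 2 * \<i>)) :: complex) = h * f"
    "exp (2 * pi * (\<alpha> * (z1 + \<beta> * \<i>) - \<beta> * z2) :: complex) = Q * f"
    "exp (2 * pi * (\<alpha> * (z1 - \<beta> * \<i>) - \<beta> * z2) :: complex) = inverse Q * f"
    "exp (2 * pi * (\<beta> * (z2 + \<alpha> * \<i>) - \<alpha> * z1) :: complex) = Q * e"
    "exp (2 * pi * (\<beta> * (z2 - \<alpha> * \<i>) - \<alpha> * z1) :: complex) = inverse Q * e"
    by (simp_all add: e_def f_def h_def Q_def qpow_def exp_add[symmetric] exp_minus[symmetric]
        ab' algebra_simps)
  have lam0: "Q - inverse Q \<noteq> 0" using lam_nonzero[OF q] by (simp add: Q_def)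
  note simps = free_act_diff free_act_mult free_act_one free_act_gen free_act_scal
    power2_eq_square z shifts hi e_def[symmetric] f_def[symmetric] h_def[symmetric] Q_def[symmetric]
  have comm: "free_act \<gamma> \<alpha> \<beta> (gen GenE * gen GenF - gen GenF * gen GenE
       - scal (inverse (lam \<gamma>)) * ((gen GenK1 * gen GenK2inv)^2 - (gen GenK2 * gen GenK1inv)^2)) a z = 0"
  proof -
    define app where "app = a (z1 + \<beta> * \<i>, z2 + \<alpha> * \<i>)"
    define apm where "apm = a (z1 + \<beta> * \<i>, z2 - \<alpha> * \<i>)"
    define amp where "amp = a (z1 - \<beta> * \<i>, z2 + \<alpha> * \<i>)"
    define amm where "amm = a (z1 - \<beta> * \<i>, z2 - \<alpha> * \<i>)"
    define L where "L = inverse (Q - inverse Q)"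
    have half: "w - c / 2 * \<i> - c / 2 * \<i> = w - c * \<i>" "w + c / 2 * \<i> + c / 2 * \<i> = w + c * \<i>"
      for w c :: complex by (simp_all add: algebra_simps)
    have EF: "free_act \<gamma> \<alpha> \<beta> (gen GenE * gen GenF) a z
       = L * e * (L * (Q * f) * (app - apm) - L * (inverse Q * f) * (amp - amm))"
      by (simp only: simps gen_act.simps prod.case L_def app_def apm_def amp_def amm_def)
    have FE: "free_act \<gamma> \<alpha> \<beta> (gen GenF * gen GenE) a z
       = L * f * (L * (Q * e) * (app - amp) - L * (inverse Q * e) * (apm - amm))"
      by (simp only: simps gen_act.simps prod.case L_def app_def apm_def amp_def amm_def)
    have K: "free_act \<gamma> \<alpha> \<beta> ((gen GenK1 * gen GenK2inv)^2) a z = amp"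
      "free_act \<gamma> \<alpha> \<beta> ((gen GenK2 * gen GenK1inv)^2) a z = apm"
      by (simp_all only: simps gen_act.simps prod.case half amp_def apm_def)
    have "free_act \<gamma> \<alpha> \<beta> (gen GenE * gen GenF) a z - free_act \<gamma> \<alpha> \<beta> (gen GenF * gen GenE) a z
      = (e * f) * L * (L * (Q - inverse Q)) * (amp - apm)"
      unfolding EF FE by (simp add: algebra_simps)
    also have "\<dots> = L * (amp - apm)"
      using lam0 by (simp add: ef L_def)
    finally have "free_act \<gamma> \<alpha> \<beta> (gen GenE * gen GenF) a z
      - free_act \<gamma> \<alpha> \<beta> (gen GenF * gen GenE) a z = L * (amp - apm)" .
    moreover have "free_act \<gamma> \<alpha> \<beta> (scal (inverse (lam \<gamma>))
        * ((gen GenK1 * gen GenK2inv)^2 - (gen GenK2 * gen GenK1inv)^2)) a z = L * (amp - apm)"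
      by (simp only: free_act_mult[of _ _ _ "scal _"] free_act_scal free_act_diff K L_def Q_def)
    ultimately show ?thesis by (simp only: free_act_diff diff_self)
  qed
  have cancel: "w - c / 2 * \<i> + c / 2 * \<i> = w" "w + c / 2 * \<i> - c / 2 * \<i> = w"
    "w - c / 2 * \<i> + d + c / 2 * \<i> = w + d" "w - c / 2 * \<i> - d + c / 2 * \<i> = w - d"
    for w c d :: complex by (simp_all add: algebra_simps)
  have assoc: "l * (g * c) * d = g * (l * c * d)" for l g c d :: complex
    by simp
  note conj = simps gen_act.simps prod.case cancel assoc diff_self
  show ?thesis
    using p unfolding uq_relators_def
    by (elim insertE emptyE; simp only: comm) (simp_all only: conj)
qed

lemma uq_free_ring: "ring uq_free_ring"
proof -
  have "\<exists>y. x + y = 0" for x :: uq_free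
    by (rule exI[of _ "- x"]) simp
  moreover have "\<exists>y. y + x = 0" for x :: uq_free
    by (rule exI[of _ "- x"]) simp
  ultimately show ?thesis
    unfolding ring_of_type_algebra_def
    by unfold_locales (auto simp: algebra_simps Units_def)
qed

lemma uq_free_uminus: "\<ominus>\<^bsub>uq_free_ring\<^esub> p = - p"
proof -
  interpret ring uq_free_ring by (rule uq_free_ring)
  show ?thesis
    by (rule minus_equality) (auto simp: ring_of_type_algebra_def)
qed

lemma free_act_ideal:
  assumes q: "qpow \<gamma> 1 \<noteq> 1" "qpow \<gamma> 1 \<noteq> -1" and ab: "\<alpha> * \<beta> = \<gamma>"
    and p: "p \<in> uq_ideal \<gamma>"
  shows "free_act \<gamma> \<alpha> \<beta> p a z = 0"
proof -
  interpret ring uq_free_ring by (rule uq_free_ring)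
  let ?I = "{p. \<forall>a. free_act \<gamma> \<alpha> \<beta> p a = (\<lambda>z. 0)}"
  have zero: "free_act \<gamma> \<alpha> \<beta> p (\<lambda>z. 0) = (\<lambda>z. 0)" for p
    using free_act_lin[of \<gamma> \<alpha> \<beta> p 0 "\<lambda>z. 0" 0 "\<lambda>z. 0"] by simp
  have "ideal ?I uq_free_ring"
  proof (rule idealI)
    show "subgroup ?I (add_monoid uq_free_ring)"
    proof (rule add.subgroupI)
      fix p assume "p \<in> ?I"
      then show "\<ominus>\<^bsub>uq_free_ring\<^esub> p \<in> ?I"
        by (simp add: uq_free_uminus fun_eq_iff free_act_uminus)
    next
      fix p r assume "p \<in> ?I" "r \<in> ?I"
      then show "p \<oplus>\<^bsub>uq_free_ring\<^esub> r \<in> ?I"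
        by (simp add: ring_of_type_algebra_def fun_eq_iff free_act_add)
    next
      show "?I \<noteq> {}" by (auto simp: fun_eq_iff intro!: exI[of _ 0])
    qed (simp add: ring_of_type_algebra_def)
  qed (rule uq_free_ring, auto simp: ring_of_type_algebra_def free_act_mult zero)
  moreover have "uq_relators \<gamma> \<subseteq> ?I"
    using free_act_relator[OF q ab] by (auto simp: fun_eq_iff)
  ultimately have "uq_ideal \<gamma> \<subseteq> ?I"
    unfolding uq_ideal_def by (rule genideal_minimal)
  then have "\<forall>a. free_act \<gamma> \<alpha> \<beta> p a = (\<lambda>z. 0)" using p by blast
  then show ?thesis by metis
qed

lemma uq_ideal: "ideal (uq_ideal \<gamma>) uq_free_ring"
  unfolding uq_ideal_def
  by (rule ring.genideal_ideal[OF uq_free_ring]) (simp add: ring_of_type_algebra_def)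

lemma in_uq_class_iff: "r \<in> uq_class \<gamma> p \<longleftrightarrow> r - p \<in> uq_ideal \<gamma>"
  unfolding uq_class_def a_r_coset_def r_coset_def
  by (force simp: ring_of_type_algebra_def algebra_simps)

lemma uq_act_class:
  assumes q: "qpow \<gamma> 1 \<noteq> 1" "qpow \<gamma> 1 \<noteq> -1" and ab: "\<alpha> * \<beta> = \<gamma>"
  shows "uq_act \<gamma> \<alpha> \<beta> (uq_class \<gamma> p) a = free_act \<gamma> \<alpha> \<beta> p a"
proof -
  have "0 \<in> uq_ideal \<gamma>"
    using additive_subgroup.zero_closed[OF ideal.axioms(1)[OF uq_ideal]]
    by (simp add: ring_of_type_algebra_def)
  then have "p \<in> uq_class \<gamma> p"
    by (simp add: in_uq_class_iff)
  then have "(SOME r. r \<in> uq_class \<gamma> p) \<in> uq_class \<gamma> p" by (rule someI)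
  then have "(SOME r. r \<in> uq_class \<gamma> p) - p \<in> uq_ideal \<gamma>" by (simp add: in_uq_class_iff)
  from free_act_ideal[OF q ab this] show ?thesis
    by (simp add: uq_act_def fun_eq_iff free_act_diff)
qed

lemma uq_carrier: "carrier (Uq \<gamma>) = range (uq_class \<gamma>)"
  by (auto simp: Uq_def FactRing_def A_RCOSETS_defs a_r_coset_def uq_class_def ring_of_type_algebra_def)

lemma uq_class_mult: "uq_class \<gamma> p \<otimes>\<^bsub>Uq \<gamma>\<^esub> uq_class \<gamma> r = uq_class \<gamma> (p * r)"
  using ideal.rcoset_mult_add[OF uq_ideal, of p r]
  by (simp add: Uq_def FactRing_simps uq_class_def ring_of_type_algebra_def)

lemma uq_class_add: "uq_class \<gamma> p \<oplus>\<^bsub>Uq \<gamma>\<^esub> uq_class \<gamma> r = uq_class \<gamma> (p + r)"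
  using ideal.a_rcos_sum[OF uq_ideal, of p r]
  by (simp add: Uq_def FactRing_simps uq_class_def ring_of_type_algebra_def)

lemma uq_act_module:
  assumes q: "qpow \<gamma> 1 \<noteq> 1" "qpow \<gamma> 1 \<noteq> -1" and ab: "\<alpha> * \<beta> = \<gamma>"
    and fg: "f \<in> carrier (Uq \<gamma>)" "g \<in> carrier (Uq \<gamma>)"
  shows "uq_act \<gamma> \<alpha> \<beta> (f \<otimes>\<^bsub>Uq \<gamma>\<^esub> g) a = uq_act \<gamma> \<alpha> \<beta> f (uq_act \<gamma> \<alpha> \<beta> g a)"
    and "uq_act \<gamma> \<alpha> \<beta> (f \<oplus>\<^bsub>Uq \<gamma>\<^esub> g) a z = uq_act \<gamma> \<alpha> \<beta> f a z + uq_act \<gamma> \<alpha> \<beta> g a z"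
    and "uq_act \<gamma> \<alpha> \<beta> (uq_class \<gamma> (scal c)) a = (\<lambda>z. c * a z)"
    and "uq_act \<gamma> \<alpha> \<beta> (uq_class \<gamma> (gen x)) a = gen_act \<gamma> \<alpha> \<beta> x a"
  using fg
  by (auto simp: uq_carrier uq_class_mult uq_class_add uq_act_class[OF q ab] free_act_mult
      free_act_add free_act_scal free_act_gen)

definition restr :: "fun2 \<Rightarrow> real \<times> real \<Rightarrow> complex" where
  "restr a = (\<lambda>(x1, x2). a (complex_of_real x1, complex_of_real x2))"

text \<open>Meaningful for square integrable \<open>f\<close>, which is the only case used.\<close>

definition l2_norm :: "(real \<times> real \<Rightarrow> complex) \<Rightarrow> real" where
  "l2_norm f = sqrt (LINT x|lborel. (cmod (f x))\<^sup>2)"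

definition exp_Q :: "real \<times> real \<Rightarrow> (real \<times> real \<Rightarrow> complex) \<Rightarrow> (real \<times> real \<Rightarrow> complex)" where
  "exp_Q = (\<lambda>(c1, c2) f (x1, x2). complex_of_real (exp (2 * pi * (c1 * x1 + c2 * x2))) * f (x1, x2))"

definition exp_P :: "real \<times> real \<Rightarrow> fun2 \<Rightarrow> fun2" where
  "exp_P = (\<lambda>(d1, d2) a (z1, z2). a (z1 - \<i> * complex_of_real d1, z2 - \<i> * complex_of_real d2))"

definition S_exp_Q :: "real \<times> real \<Rightarrow> (real \<times> real \<Rightarrow> complex) \<Rightarrow> (real \<times> real \<Rightarrow> complex)" where
  "S_exp_Q = (\<lambda>(\<epsilon>1, \<epsilon>2) f (x1, x2). complex_of_real
      ((exp (2 * pi * \<epsilon>1 * x1) + exp (- 2 * pi * \<epsilon>1 * x1)) *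
       (exp (2 * pi * \<epsilon>2 * x2) + exp (- 2 * pi * \<epsilon>2 * x2))) * f (x1, x2))"

definition tau_norm :: "real \<times> real \<Rightarrow> real \<times> real \<Rightarrow> fun2 \<Rightarrow> real" where
  "tau_norm c d a = l2_norm (exp_Q c (restr (exp_P d a)))"

definition tau :: "fun2 topology" where
  "tau = topology_generated_by
     {{b \<in> space_A. tau_norm c d (\<lambda>z. b z - a z) < r} | a c d r. a \<in> space_A \<and> r > 0}"

definition alpha_k :: "real \<Rightarrow> real \<Rightarrow> int \<Rightarrow> real" where
  "alpha_k \<alpha> \<beta> k1 = \<alpha> + 2 * inverse \<beta> * of_int k1"

definition beta_k :: "real \<Rightarrow> real \<Rightarrow> int \<Rightarrow> real" where
  "beta_k \<alpha> \<beta> k2 = \<beta> + 2 * inverse \<alpha> * of_int k2"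

definition h_integrand :: "real \<Rightarrow> real \<Rightarrow> int \<times> int \<Rightarrow> fun2 \<Rightarrow> real \<times> real \<Rightarrow> complex" where
  "h_integrand \<alpha> \<beta> = (\<lambda>(k1, k2) a (x1, x2).
     complex_of_real (exp (2 * pi * (alpha_k \<alpha> \<beta> k1 * x1 + beta_k \<alpha> \<beta> k2 * x2)))
     * a (complex_of_real x1, complex_of_real x2))"

definition h_fun :: "real \<Rightarrow> real \<Rightarrow> int \<times> int \<Rightarrow> fun2 \<Rightarrow> complex" where
  "h_fun \<alpha> \<beta> k a = (LINT x|lborel. h_integrand \<alpha> \<beta> k a x)"

end

theory Submission
  imports Defs "HOL-Complex_Analysis.Complex_Analysis" "HOL-Real_Asymp.Real_Asymp"
begin

text \<open>The functional is \<open>h\<^sub>k a = \<integral> e\<^sub>k a\<close> with \<open>e\<^sub>k\<close> the exponential of a linear form. By Cauchy's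
  theorem the integral over \<open>\<real>\<^sup>2\<close> does not change when the contour is moved by imaginary amounts, so
  an imaginary shift of \<open>a\<close> only multiplies \<open>h\<^sub>k a\<close> by a constant. The choice of \<open>\<alpha>\<^sub>k\<close>, \<open>\<beta>\<^sub>k\<close>
  makes this constant \<open>q\<^bsup>1/2\<^esup>\<close> for \<open>K\<^sub>1\<close>, \<open>K\<^sub>2\<close>, and for \<open>E\<close>, \<open>F\<close> it makes the two shifted terms
  cancel. Part (ii) is the translation invariance of Lebesgue measure. Part (iii) is the
  Cauchy-Schwarz inequality for \<open>S\<close> and \<open>1/S\<close>, using
  \<open>\<integral> (e\<^bsup>2\<pi>\<epsilon>x\<^esup> + e\<^bsup>-2\<pi>\<epsilon>x\<^esup>)\<^bsup>-2\<^esup> dx \<le> \<integral> e\<^bsup>-4\<pi>\<epsilon>|x|\<^esup> dx = 1/(2\<pi>\<epsilon>)\<close>.\<close>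

subsection \<open>Closure properties of the function space\<close>

text \<open>Membership in \<open>space_A\<close> bounds weighted L2 norms on the planes of constant
  imaginary part and gives no pointwise decay, so the vertical sides of a rectangular contour cannot
  be estimated directly. Instead the weights turn the L2 bounds into L1 bounds uniform in the
  imaginary parts. Integrating over the heights makes the strip integral in the first variable
  finite for almost every value of the second, and there a primitive replaces the rectangle. The
  second variable follows by exchanging coordinates. For an exponential e^(p x1), an imaginary shift
  by r costs the phase e^(-i p r). With p = 2 pi \<open>alpha_k\<close> one has p \<beta> = 2 pi
  (\<gamma> + 2 k1). The factor 2 in \<open>alpha_k\<close> is dictated by K1, which shifts by
  \<beta>/2 only: without it the value q^(1/2) would acquire the sign (-1)^k1. For E the exponential
  prefactor lowers p by 2 pi \<alpha>, so p \<beta> becomes 4 pi k1 and the shifts by \<beta> and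
  -\<beta> both have phase 1. Since U_q is a quotient of the free algebra, covariance is checked on
  generators, carried along words, and passed to cosets; the character is built in the same
  way.\<close>

definition weighted_sq :: "fun2 \<Rightarrow> real \<Rightarrow> real \<Rightarrow> real \<Rightarrow> real \<Rightarrow> ennreal" where
  "weighted_sq a \<mu>1 \<mu>2 y1 y2 =
     (\<integral>\<^sup>+ (x1, x2). ennreal ((cmod (a (Complex x1 y1, Complex x2 y2)))\<^sup>2
        * exp (4 * pi * (\<mu>1 * \<bar>x1\<bar> + \<mu>2 * \<bar>x2\<bar>))) \<partial>(lborel :: (real \<times> real) measure))"

text \<open>Replacing the finite supremum by a uniform bound C reduces each closure property below
  to exhibiting a new bound built from old ones.\<close>

lemma space_A_iff:
  "a \<in> space_A \<longleftrightarrow> entire2 a \<and>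
     (\<forall>\<mu>1>0. \<forall>\<mu>2>0. \<forall>\<nu>1>0. \<forall>\<nu>2>0. \<exists>C<\<infinity>. \<forall>y1 y2.
        \<bar>y1\<bar> < \<nu>1 \<and> \<bar>y2\<bar> < \<nu>2 \<longrightarrow> weighted_sq a \<mu>1 \<mu>2 y1 y2 \<le> C)"
proof -
  have "(SUP (y1, y2) \<in> {-\<nu>1<..<\<nu>1} \<times> {-\<nu>2<..<\<nu>2}. weighted_sq a \<mu>1 \<mu>2 y1 y2) < \<infinity> \<longleftrightarrow>
      (\<exists>C<\<infinity>. \<forall>y1 y2. \<bar>y1\<bar> < \<nu>1 \<and> \<bar>y2\<bar> < \<nu>2 \<longrightarrow> weighted_sq a \<mu>1 \<mu>2 y1 y2 \<le> C)"
    (is "?S < \<infinity> \<longleftrightarrow> ?R") for \<mu>1 \<mu>2 \<nu>1 \<nu>2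
  proof
    assume "?S < \<infinity>"
    moreover have "weighted_sq a \<mu>1 \<mu>2 y1 y2 \<le> ?S" if "\<bar>y1\<bar> < \<nu>1 \<and> \<bar>y2\<bar> < \<nu>2" for y1 y2
      by (rule SUP_upper2[of "(y1, y2)"]) (use that in auto)
    ultimately show ?R by blast
  next
    assume ?R
    then obtain C where C: "C < \<infinity>" "\<And>y1 y2. \<bar>y1\<bar> < \<nu>1 \<and> \<bar>y2\<bar> < \<nu>2 \<Longrightarrow> weighted_sq a \<mu>1 \<mu>2 y1 y2 \<le> C"
      by blast
    have "?S \<le> C" by (rule SUP_least) (auto intro!: C(2))
    with C(1) show "?S < \<infinity>" by (rule le_less_trans[rotated])
  qed
  then show ?thesis
    unfolding space_A_def weighted_sq_def by simp
qed

lemma space_A_E: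
  assumes "a \<in> space_A" "0 < \<mu>1" "0 < \<mu>2" "0 < \<nu>1" "0 < \<nu>2"
  obtains C where "C < \<infinity>" "\<And>y1 y2. \<bar>y1\<bar> < \<nu>1 \<Longrightarrow> \<bar>y2\<bar> < \<nu>2 \<Longrightarrow> weighted_sq a \<mu>1 \<mu>2 y1 y2 \<le> C"
  using assms unfolding space_A_iff by metis

lemma space_A_I:
  assumes "entire2 a"
    and "\<And>\<mu>1 \<mu>2 \<nu>1 \<nu>2. 0 < \<mu>1 \<Longrightarrow> 0 < \<mu>2 \<Longrightarrow> 0 < \<nu>1 \<Longrightarrow> 0 < \<nu>2 \<Longrightarrow>
      \<exists>C<\<infinity>. \<forall>y1 y2. \<bar>y1\<bar> < \<nu>1 \<and> \<bar>y2\<bar> < \<nu>2 \<longrightarrow> weighted_sq a \<mu>1 \<mu>2 y1 y2 \<le> C"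
  shows "a \<in> space_A"
  using assms unfolding space_A_iff by blast

lemma space_A_entire2: "a \<in> space_A \<Longrightarrow> entire2 a"
  by (simp add: space_A_iff)

lemma entire2_imp_continuous_on:
  assumes "entire2 a" shows "continuous_on S a"
proof -
  have "isCont a z" for z
    using assms has_derivative_continuous unfolding entire2_def by blast
  then show ?thesis by (simp add: continuous_at_imp_continuous_on)
qed

lemma continuous_on_entire2 [continuous_intros]:
  "entire2 a \<Longrightarrow> continuous_on S f \<Longrightarrow> continuous_on S (\<lambda>x. a (f x))"
  by (rule continuous_on_compose2[OF entire2_imp_continuous_on[of _ UNIV]]) auto

lemma measurable_entire2:
  assumes "entire2 a"
  shows "(\<lambda>(x1, x2). a (Complex x1 y1, Complex x2 y2)) \<in> borel_measurable lborel"
  unfolding case_prod_beta measurable_lborel2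
  by (intro borel_measurable_continuous_onI continuous_on_entire2[OF assms]) (auto intro!: continuous_intros)

lemma measurable_weighted_sq:
  assumes "entire2 a"
  shows "(\<lambda>(x1, x2). ennreal ((cmod (a (Complex x1 y1, Complex x2 y2)))\<^sup>2
        * exp (4 * pi * (\<mu>1 * \<bar>x1\<bar> + \<mu>2 * \<bar>x2\<bar>)))) \<in> borel_measurable (borel :: (real \<times> real) measure)"
  unfolding case_prod_unfold
  by (intro measurable_compose[OF _ measurable_ennreal] borel_measurable_continuous_onI
      continuous_intros continuous_on_entire2[OF assms])

lemma entire2_lin:
  assumes "entire2 a" "entire2 b"
  shows "entire2 (\<lambda>z. c * a z + d * b z)"
  unfolding entire2_def
proof
  fix z
  obtain a1 a2 b1 b2 where 
    a: "(a has_derivative (\<lambda>(h1, h2). a1 * h1 + a2 * h2)) (at z)" and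
    b: "(b has_derivative (\<lambda>(h1, h2). b1 * h1 + b2 * h2)) (at z)"
    using assms unfolding entire2_def by metis
  show "\<exists>c1 c2. ((\<lambda>z. c * a z + d * b z) has_derivative (\<lambda>(h1, h2). c1 * h1 + c2 * h2)) (at z)"
    by (rule exI[of _ "c * a1 + d * b1"], rule exI[of _ "c * a2 + d * b2"])
      (rule derivative_eq_intros a b refl | auto simp: fun_eq_iff algebra_simps)+
qed

lemma entire2_shift:
  assumes "entire2 a"
  shows "entire2 (\<lambda>(z1, z2). a (z1 + u1, z2 + u2))"
  unfolding entire2_def
proof
  fix z :: "complex \<times> complex"
  obtain a1 a2 where 
    a: "(a has_derivative (\<lambda>(h1, h2). a1 * h1 + a2 * h2)) (at (z + (u1, u2)))"
    using assms unfolding entire2_def by metis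
  have "((\<lambda>z. a (z + (u1, u2))) has_derivative (\<lambda>(h1, h2). a1 * h1 + a2 * h2)) (at z)"
    by (rule has_derivative_compose[of "\<lambda>z. z + (u1, u2)" "\<lambda>h. h"])
       (auto intro!: derivative_eq_intros a)
  then show "\<exists>c1 c2. ((\<lambda>(z1, z2). a (z1 + u1, z2 + u2)) has_derivative (\<lambda>(h1, h2). c1 * h1 + c2 * h2)) (at z)"
    unfolding case_prod_unfold plus_prod_def fst_conv snd_conv by blast
qed

lemma entire2_exp:
  assumes "entire2 a"
  shows "entire2 (\<lambda>(z1, z2). exp (p * z1 + q * z2) * a (z1, z2))"
  unfolding entire2_def
proof
  fix z :: "complex \<times> complex"
  obtain a1 a2 where 
    a: "(a has_derivative (\<lambda>(h1, h2). a1 * h1 + a2 * h2)) (at z)"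
    using assms unfolding entire2_def by metis
  define e where "e = (\<lambda>z :: complex \<times> complex. exp (p * fst z + q * snd z))"
  have l: "((\<lambda>z. p * fst z + q * snd z) has_derivative (\<lambda>h. p * fst h + q * snd h)) (at z)"
    by (auto intro!: derivative_eq_intros)
  have e: "(e has_derivative (\<lambda>(h1, h2). e z * p * h1 + e z * q * h2)) (at z)"
    unfolding e_def
    using has_derivative_compose[OF l, of exp "(*) (exp (p * fst z + q * snd z))"] DERIV_exp[of "p * fst z + q * snd z"]
    by (simp add: has_field_derivative_def case_prod_unfold algebra_simps)
  have "((\<lambda>z. e z * a z) has_derivative
    (\<lambda>(h1, h2). (e z * a1 + e z * p * a z) * h1 + (e z * a2 + e z * q * a z) * h2)) (at z)"
    by (rule has_derivative_eq_rhs[OF has_derivative_mult[OF e a]])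
       (auto simp: fun_eq_iff algebra_simps)
  then show "\<exists>c1 c2. ((\<lambda>(z1, z2). exp (p * z1 + q * z2) * a (z1, z2)) has_derivative
      (\<lambda>(h1, h2). c1 * h1 + c2 * h2)) (at z)"
    unfolding e_def case_prod_beta prod.collapse by blast
qed

lemma entire2_swap:
  assumes "entire2 a"
  shows "entire2 (a \<circ> prod.swap)"
  unfolding entire2_def
proof
  fix z :: "complex \<times> complex"
  obtain a1 a2 where 
    a: "(a has_derivative (\<lambda>(h1, h2). a1 * h1 + a2 * h2)) (at (prod.swap z))"
    using assms unfolding entire2_def by metis
  have s: "(prod.swap has_derivative prod.swap) (at z)" for z :: "complex \<times> complex"
    unfolding prod.swap_def by (auto intro!: derivative_eq_intros)
  have "(a \<circ> prod.swap has_derivative (\<lambda>(h1, h2). a2 * h1 + a1 * h2)) (at z)"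
    unfolding o_def
    by (rule has_derivative_eq_rhs[OF has_derivative_compose[OF s a]])
      (auto simp: fun_eq_iff)
  then show "\<exists>c1 c2. (a \<circ> prod.swap has_derivative (\<lambda>(h1, h2). c1 * h1 + c2 * h2)) (at z)"
    by blast
qed

text \<open>This is the passage to one complex variable: composing the total derivative with h ->
  (h, 0) leaves multiplication by its first coefficient.\<close>

lemma holomorphic_entire2_fst:
  assumes "entire2 a"
  shows "(\<lambda>z. a (z, w)) holomorphic_on UNIV"
proof (rule holomorphic_onI)
  fix z
  obtain a1 a2 where 
    a: "(a has_derivative (\<lambda>(h1, h2). a1 * h1 + a2 * h2)) (at (z, w))"
    using assms unfolding entire2_def by metis
  have "((\<lambda>z. (z, w)) has_derivative (\<lambda>h. (h, 0))) (at z)"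
    by (auto intro!: derivative_eq_intros)
  from has_derivative_compose[OF this a]
  have "((\<lambda>z. a (z, w)) has_field_derivative a1) (at z)"
    by (simp add: has_field_derivative_def)
  then show "(\<lambda>z. a (z, w)) field_differentiable at z within UNIV"
    by (auto simp: field_differentiable_def)
qed

lemma cmod_lin_sq_le: "(cmod (c * u + d * v))\<^sup>2 \<le> 2 * (cmod c)\<^sup>2 * (cmod u)\<^sup>2 + 2 * (cmod d)\<^sup>2 * (cmod v)\<^sup>2"
proof -
  have "(cmod (c * u + d * v))\<^sup>2 \<le> (cmod c * cmod u + cmod d * cmod v)\<^sup>2"
    by (intro power_mono order_trans[OF norm_triangle_ineq]) (auto simp: norm_mult)
  also have "\<dots> \<le> 2 * (cmod c)\<^sup>2 * (cmod u)\<^sup>2 + 2 * (cmod d)\<^sup>2 * (cmod v)\<^sup>2"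
    \<comment> \<open>The mixed term 2 u v of the square is at most u^2 + v^2.\<close>
    using zero_le_power2[of "cmod c * cmod u - cmod d * cmod v"]
    by (simp add: power2_eq_square algebra_simps)
  finally show ?thesis .
qed

lemma space_A_lin:
  assumes a: "a \<in> space_A" and b: "b \<in> space_A"
  shows "(\<lambda>z. c * a z + d * b z) \<in> space_A"
proof (rule space_A_I)
  show "entire2 (\<lambda>z. c * a z + d * b z)"
    by (intro entire2_lin space_A_entire2 a b)
  fix \<mu>1 \<mu>2 \<nu>1 \<nu>2 :: real assume pos: "0 < \<mu>1" "0 < \<mu>2" "0 < \<nu>1" "0 < \<nu>2"
  obtain A where A: "A < \<infinity>" "\<And>y1 y2. \<bar>y1\<bar> < \<nu>1 \<Longrightarrow> \<bar>y2\<bar> < \<nu>2 \<Longrightarrow> weighted_sq a \<mu>1 \<mu>2 y1 y2 \<le> A"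
    using space_A_E[OF a pos] by blast
  obtain B where B: "B < \<infinity>" "\<And>y1 y2. \<bar>y1\<bar> < \<nu>1 \<Longrightarrow> \<bar>y2\<bar> < \<nu>2 \<Longrightarrow> weighted_sq b \<mu>1 \<mu>2 y1 y2 \<le> B"
    using space_A_E[OF b pos] by blast
  define C D where "C = 2 * (cmod c)\<^sup>2" and "D = 2 * (cmod d)\<^sup>2"
  have CD: "0 \<le> C" "0 \<le> D" by (auto simp: C_def D_def)
  have "weighted_sq (\<lambda>z. c * a z + d * b z) \<mu>1 \<mu>2 y1 y2 \<le>
     ennreal C * weighted_sq a \<mu>1 \<mu>2 y1 y2 + ennreal D * weighted_sq b \<mu>1 \<mu>2 y1 y2" for y1 y2
  proof -
    have "weighted_sq (\<lambda>z. c * a z + d * b z) \<mu>1 \<mu>2 y1 y2 \<le> 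
     (\<integral>\<^sup>+ x. ennreal C * (case x of (x1, x2) \<Rightarrow> ennreal ((cmod (a (Complex x1 y1, Complex x2 y2)))\<^sup>2
        * exp (4 * pi * (\<mu>1 * \<bar>x1\<bar> + \<mu>2 * \<bar>x2\<bar>)))) +
       ennreal D * (case x of (x1, x2) \<Rightarrow> ennreal ((cmod (b (Complex x1 y1, Complex x2 y2)))\<^sup>2
        * exp (4 * pi * (\<mu>1 * \<bar>x1\<bar> + \<mu>2 * \<bar>x2\<bar>)))) \<partial>(lborel :: (real \<times> real) measure))"
      unfolding weighted_sq_def
    proof (rule nn_integral_mono, clarify)
      fix x1 x2 :: real
      define u v where "u = a (Complex x1 y1, Complex x2 y2)" and "v = b (Complex x1 y1, Complex x2 y2)"
      define e where "e = exp (4 * pi * (\<mu>1 * \<bar>x1\<bar> + \<mu>2 * \<bar>x2\<bar>))"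
      have "(cmod (c * u + d * v))\<^sup>2 * e \<le> (C * (cmod u)\<^sup>2 + D * (cmod v)\<^sup>2) * e"
        unfolding C_def D_def by (intro mult_right_mono cmod_lin_sq_le) (simp add: e_def)
      then show "ennreal ((cmod (c * a (Complex x1 y1, Complex x2 y2) + d * b (Complex x1 y1, Complex x2 y2)))\<^sup>2 * exp (4 * pi * (\<mu>1 * \<bar>x1\<bar> + \<mu>2 * \<bar>x2\<bar>)))
         \<le> ennreal C * ennreal ((cmod (a (Complex x1 y1, Complex x2 y2)))\<^sup>2 * exp (4 * pi * (\<mu>1 * \<bar>x1\<bar> + \<mu>2 * \<bar>x2\<bar>))) 
         + ennreal D * ennreal ((cmod (b (Complex x1 y1, Complex x2 y2)))\<^sup>2 * exp (4 * pi * (\<mu>1 * \<bar>x1\<bar> + \<mu>2 * \<bar>x2\<bar>)))"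
        unfolding u_def[symmetric] v_def[symmetric] e_def[symmetric]
        using CD by (simp add: ennreal_mult[symmetric] ennreal_plus[symmetric] e_def algebra_simps del: ennreal_plus)
    qed
    also have "\<dots> = ennreal C * weighted_sq a \<mu>1 \<mu>2 y1 y2 + ennreal D * weighted_sq b \<mu>1 \<mu>2 y1 y2"
      unfolding weighted_sq_def 
      using measurable_weighted_sq[OF space_A_entire2[OF a]] measurable_weighted_sq[OF space_A_entire2[OF b]]
      by (subst nn_integral_add) (auto simp: nn_integral_cmult intro!: borel_measurable_times_ennreal)
    finally show ?thesis .
  qed
  then have "\<forall>y1 y2. \<bar>y1\<bar> < \<nu>1 \<and> \<bar>y2\<bar> < \<nu>2 \<longrightarrow>
    weighted_sq (\<lambda>z. c * a z + d * b z) \<mu>1 \<mu>2 y1 y2 \<le> ennreal C * A + ennreal D * B"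
    by (meson A(2) B(2) add_mono mult_left_mono order_trans zero_le)
  moreover have "ennreal C * A + ennreal D * B < \<infinity>"
    using A(1) B(1) by (simp add: ennreal_mult_less_top)
  ultimately show "\<exists>C<\<infinity>. \<forall>y1 y2. \<bar>y1\<bar> < \<nu>1 \<and> \<bar>y2\<bar> < \<nu>2 \<longrightarrow>
      weighted_sq (\<lambda>z. c * a z + d * b z) \<mu>1 \<mu>2 y1 y2 \<le> C" by blast
qed

text \<open>Imaginary shifts, the multiplications \<open>exp_mult\<close> and linear combinations
  suffice to write down the action of every generator, see
  \<open>gen_act_exp_mult_imag_shift\<close>.\<close>

definition imag_shift :: "real \<Rightarrow> real \<Rightarrow> fun2 \<Rightarrow> fun2" where
  "imag_shift r1 r2 a = (\<lambda>(z1, z2). a (z1 + \<i> * complex_of_real r1, z2 + \<i> * complex_of_real r2))"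

definition exp_mult :: "real \<Rightarrow> real \<Rightarrow> fun2 \<Rightarrow> fun2" where
  "exp_mult p q a = (\<lambda>(z1, z2). exp (complex_of_real p * z1 + complex_of_real q * z2) * a (z1, z2))"

lemma space_A_imag_shift:
  assumes a: "a \<in> space_A"
  shows "imag_shift r1 r2 a \<in> space_A" (is "?b \<in> _")
proof (rule space_A_I)
  show "entire2 ?b"
    unfolding imag_shift_def by (intro entire2_shift space_A_entire2 a)
  fix \<mu>1 \<mu>2 \<nu>1 \<nu>2 :: real assume pos: "0 < \<mu>1" "0 < \<mu>2" "0 < \<nu>1" "0 < \<nu>2"
  \<comment> \<open>The strip widths in \<open>space_A\<close> are arbitrary, so a shift is absorbed
    by widening the strip.\<close>
  then have "0 < \<nu>1 + \<bar>r1\<bar>" "0 < \<nu>2 + \<bar>r2\<bar>" by auto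
  from space_A_E[OF a pos(1,2) this]
  obtain A where A: "A < \<infinity>" "\<And>y1 y2. \<bar>y1\<bar> < \<nu>1 + \<bar>r1\<bar> \<Longrightarrow> \<bar>y2\<bar> < \<nu>2 + \<bar>r2\<bar> \<Longrightarrow> weighted_sq a \<mu>1 \<mu>2 y1 y2 \<le> A"
    by blast
  have "weighted_sq ?b \<mu>1 \<mu>2 y1 y2 = weighted_sq a \<mu>1 \<mu>2 (y1 + r1) (y2 + r2)" for y1 y2
    by (auto simp: weighted_sq_def imag_shift_def complex_eq_iff
        intro!: nn_integral_cong arg_cong[of _ _ a] arg_cong[of _ _ cmod])
  then have "\<forall>y1 y2. \<bar>y1\<bar> < \<nu>1 \<and> \<bar>y2\<bar> < \<nu>2 \<longrightarrow> weighted_sq ?b \<mu>1 \<mu>2 y1 y2 \<le> A"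
    by (auto intro!: A(2))
  with A(1) show "\<exists>C<\<infinity>. \<forall>y1 y2. \<bar>y1\<bar> < \<nu>1 \<and> \<bar>y2\<bar> < \<nu>2 \<longrightarrow> weighted_sq ?b \<mu>1 \<mu>2 y1 y2 \<le> C"
    by blast
qed

text \<open>For real p and q the modulus of the exponential depends on the real parts only. Its
  square is at most exp(4 pi (|p| |x1| + |q| |x2|)), because 2 \<le> 4 pi, and this is absorbed by
  raising the arbitrary weights to \<mu>1 + |p| and \<mu>2 + |q|.\<close>

lemma space_A_exp_mult:
  assumes a: "a \<in> space_A"
  shows "exp_mult p q a \<in> space_A" (is "?b \<in> _")
proof (rule space_A_I)
  show "entire2 ?b"
    unfolding exp_mult_def by (intro entire2_exp space_A_entire2 a)
  fix \<mu>1 \<mu>2 \<nu>1 \<nu>2 :: real assume pos: "0 < \<mu>1" "0 < \<mu>2" "0 < \<nu>1" "0 < \<nu>2"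
  then have "0 < \<mu>1 + \<bar>p\<bar>" "0 < \<mu>2 + \<bar>q\<bar>" by auto
  from space_A_E[OF a this pos(3,4)]
  obtain A where A: "A < \<infinity>" "\<And>y1 y2. \<bar>y1\<bar> < \<nu>1 \<Longrightarrow> \<bar>y2\<bar> < \<nu>2 \<Longrightarrow>
      weighted_sq a (\<mu>1 + \<bar>p\<bar>) (\<mu>2 + \<bar>q\<bar>) y1 y2 \<le> A"
    by blast
  have "weighted_sq ?b \<mu>1 \<mu>2 y1 y2 \<le> weighted_sq a (\<mu>1 + \<bar>p\<bar>) (\<mu>2 + \<bar>q\<bar>) y1 y2" for y1 y2
    unfolding weighted_sq_def exp_mult_def prod.case
  proof (rule nn_integral_mono, clarify)
    fix x1 x2 :: real
    have pt: "2 * (r * x) \<le> 4 * pi * (\<bar>r\<bar> * \<bar>x\<bar>)" for r x :: real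
    proof -
      have "2 * (r * x) \<le> 4 * (\<bar>r\<bar> * \<bar>x\<bar>)" by (simp add: abs_mult[symmetric])
      also have "\<dots> \<le> 4 * pi * (\<bar>r\<bar> * \<bar>x\<bar>)"
        using pi_ge_two by (intro mult_right_mono) auto
      finally show ?thesis .
    qed
    have "2 * (p * x1 + q * x2) + 4 * pi * (\<mu>1 * \<bar>x1\<bar> + \<mu>2 * \<bar>x2\<bar>)
        \<le> 4 * pi * ((\<mu>1 + \<bar>p\<bar>) * \<bar>x1\<bar> + (\<mu>2 + \<bar>q\<bar>) * \<bar>x2\<bar>)"
      using pt[of p x1] pt[of q x2] by (simp add: algebra_simps)
    then have "exp (2 * (p * x1 + q * x2)) * exp (4 * pi * (\<mu>1 * \<bar>x1\<bar> + \<mu>2 * \<bar>x2\<bar>))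
        \<le> exp (4 * pi * ((\<mu>1 + \<bar>p\<bar>) * \<bar>x1\<bar> + (\<mu>2 + \<bar>q\<bar>) * \<bar>x2\<bar>))"
      by (simp add: exp_add[symmetric])
    then have "(cmod (a (Complex x1 y1, Complex x2 y2)))\<^sup>2 * (exp (2 * (p * x1 + q * x2)) * exp (4 * pi * (\<mu>1 * \<bar>x1\<bar> + \<mu>2 * \<bar>x2\<bar>)))
        \<le> (cmod (a (Complex x1 y1, Complex x2 y2)))\<^sup>2 * exp (4 * pi * ((\<mu>1 + \<bar>p\<bar>) * \<bar>x1\<bar> + (\<mu>2 + \<bar>q\<bar>) * \<bar>x2\<bar>))"
      by (rule mult_left_mono) simp
    then show "ennreal ((cmod (exp (complex_of_real p * Complex x1 y1 + complex_of_real q * Complex x2 y2) * a (Complex x1 y1, Complex x2 y2)))\<^sup>2 *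
          exp (4 * pi * (\<mu>1 * \<bar>x1\<bar> + \<mu>2 * \<bar>x2\<bar>)))
         \<le> ennreal ((cmod (a (Complex x1 y1, Complex x2 y2)))\<^sup>2 * exp (4 * pi * ((\<mu>1 + \<bar>p\<bar>) * \<bar>x1\<bar> + (\<mu>2 + \<bar>q\<bar>) * \<bar>x2\<bar>)))"
      by (intro ennreal_leI) (simp add: norm_mult power_mult_distrib exp_double[symmetric] mult_ac)
  qed
  then have "\<forall>y1 y2. \<bar>y1\<bar> < \<nu>1 \<and> \<bar>y2\<bar> < \<nu>2 \<longrightarrow> weighted_sq ?b \<mu>1 \<mu>2 y1 y2 \<le> A"
    using A(2) order_trans by blast
  with A(1) show "\<exists>C<\<infinity>. \<forall>y1 y2. \<bar>y1\<bar> < \<nu>1 \<and> \<bar>y2\<bar> < \<nu>2 \<longrightarrow> weighted_sq ?b \<mu>1 \<mu>2 y1 y2 \<le> C"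
    by blast
qed

section \<open>Exchange of the two coordinates\<close>

lemma swap_measurable [measurable]:
  "prod.swap \<in> borel_measurable (borel :: (real \<times> real) measure)"
  by (intro borel_measurable_continuous_onI continuous_on_swap)

lemma distr_swap_lborel: "distr (lborel :: (real \<times> real) measure) lborel prod.swap = lborel"
proof -
  have "(prod.swap :: real \<times> real \<Rightarrow> _) = (\<lambda>(x, y). (y, x))" by auto
  then show ?thesis
    using lborel_pair.distr_pair_swap[where 'a=real and 'b=real] by (simp add: lborel_prod)
qed

lemma space_A_swap:
  assumes a: "a \<in> space_A"
  shows "a \<circ> prod.swap \<in> space_A"
proof (rule space_A_I)
  show "entire2 (a \<circ> prod.swap)"
    by (intro entire2_swap space_A_entire2 a)
  fix \<mu>1 \<mu>2 \<nu>1 \<nu>2 :: real assume pos: "0 < \<mu>1" "0 < \<mu>2" "0 < \<nu>1" "0 < \<nu>2"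
  from space_A_E[OF a pos(2,1,4,3)]
  obtain A where A: "A < \<infinity>" "\<And>y1 y2. \<bar>y1\<bar> < \<nu>2 \<Longrightarrow> \<bar>y2\<bar> < \<nu>1 \<Longrightarrow> weighted_sq a \<mu>2 \<mu>1 y1 y2 \<le> A"
    by blast
  have "weighted_sq (a \<circ> prod.swap) \<mu>1 \<mu>2 y1 y2 = weighted_sq a \<mu>2 \<mu>1 y2 y1" for y1 y2
  proof -
    have "weighted_sq a \<mu>2 \<mu>1 y2 y1 = (\<integral>\<^sup>+ x. (case prod.swap x of (x1, x2) \<Rightarrow>
        ennreal ((cmod (a (Complex x1 y2, Complex x2 y1)))\<^sup>2
          * exp (4 * pi * (\<mu>2 * \<bar>x1\<bar> + \<mu>1 * \<bar>x2\<bar>)))) \<partial>lborel)"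
      unfolding weighted_sq_def
      by (subst distr_swap_lborel[symmetric], subst nn_integral_distr)
         (auto simp: measurable_weighted_sq[OF space_A_entire2[OF a]])
    also have "\<dots> = weighted_sq (a \<circ> prod.swap) \<mu>1 \<mu>2 y1 y2"
      unfolding weighted_sq_def by (intro nn_integral_cong) (auto simp: add.commute)
    finally show ?thesis ..
  qed
  then have "\<forall>y1 y2. \<bar>y1\<bar> < \<nu>1 \<and> \<bar>y2\<bar> < \<nu>2 \<longrightarrow> weighted_sq (a \<circ> prod.swap) \<mu>1 \<mu>2 y1 y2 \<le> A"
    by (auto intro!: A(2))
  with A(1) show "\<exists>C<\<infinity>. \<forall>y1 y2. \<bar>y1\<bar> < \<nu>1 \<and> \<bar>y2\<bar> < \<nu>2 \<longrightarrow>
      weighted_sq (a \<circ> prod.swap) \<mu>1 \<mu>2 y1 y2 \<le> C"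
    by blast
qed

subsection \<open>Moving the contour\<close>

text \<open>A nonzero limit l would keep the norm of f above norm l / 2 on a half-line, which has
  infinite measure.\<close>

lemma integrable_limit_at_top_zero:
  fixes f :: "real \<Rightarrow> 'a :: {banach, second_countable_topology}"
  assumes f: "integrable lborel f" and lim: "(f \<longlongrightarrow> l) at_top"
  shows "l = 0"
proof (rule ccontr)
  assume "l \<noteq> 0"
  then have "eventually (\<lambda>x. dist (f x) l < norm l / 2) at_top"
    using lim by (intro tendstoD) auto
  then obtain N where N: "\<And>x. N \<le> x \<Longrightarrow> dist (f x) l < norm l / 2"
    by (auto simp: eventually_at_top_linorder)
  have ge: "norm l / 2 \<le> norm (f x)" if "N \<le> x" for x
    using N[OF that] norm_triangle_ineq2[of l "f x"] by (simp only: dist_norm norm_minus_commute)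
  have "ennreal (norm l / 2) * emeasure lborel {N..} = (\<integral>\<^sup>+ x. ennreal (norm l / 2) * indicator {N..} x \<partial>lborel)"
    by (subst nn_integral_cmult_indicator) auto
  also have "\<dots> \<le> (\<integral>\<^sup>+ x. ennreal (norm (f x)) \<partial>lborel)"
    by (intro nn_integral_mono) (auto split: split_indicator intro!: ennreal_leI dest!: ge)
  also have "\<dots> < \<infinity>"
    using f by (simp add: integrable_iff_bounded)
  finally have "ennreal (norm l / 2) * emeasure lborel {N..} < \<infinity>" .
  moreover have "emeasure lborel {N..} = \<infinity>"
  proof (rule ccontr)
    assume "emeasure lborel {N..} \<noteq> \<infinity>"
    then obtain r where r: "emeasure lborel {N..} = ennreal r" "0 \<le> r"
      by (cases "emeasure lborel {N..}") auto
    \<comment> \<open>A finite measure r is exceeded by an interval of length r + 1 inside the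
      half-line.\<close>
    have "emeasure lborel {N..N + (r + 1)} \<le> emeasure lborel {N..}"
      by (intro emeasure_mono) auto
    then show False using r by simp
  qed
  ultimately show False using \<open>l \<noteq> 0\<close> by (simp add: ennreal_mult_eq_top_iff less_top[symmetric])
qed

text \<open>The integrals of f over {-r..r} equal F r - F (-r) and converge by dominated
  convergence. So F x - F (-x), itself an integrable function of x, has a limit at infinity, which
  must be 0. No separate decay estimate for F is required.\<close>

lemma LINT_derivative_eq_0:
  fixes F f :: "real \<Rightarrow> complex"
  assumes F: "\<And>x. (F has_vector_derivative f x) (at x)" and cont: "continuous_on UNIV f"
    and int: "integrable lborel F" "integrable lborel f"
  shows "(LINT x|lborel. f x) = 0"
proof (rule integrable_limit_at_top_zero)
  have "integrable lborel (\<lambda>x. F (0 + (-1) * x))"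
    by (subst lborel_integrable_real_affine_iff) (use int in auto)
  then show "integrable lborel (\<lambda>x. F x - F (- x))"
    using int by simp
  have "((\<lambda>r. LINT x|lborel. indicator {-r..r} x *\<^sub>R f x) \<longlongrightarrow> (LINT x|lborel. f x)) at_top"
  proof (rule integral_dominated_convergence_at_top)
    show "integrable lborel (\<lambda>x. norm (f x))" using int by simp
    show "AE x in lborel. ((\<lambda>r. indicator {-r..r} x *\<^sub>R f x) \<longlongrightarrow> f x) at_top"
    proof (intro AE_I2 tendsto_eventually)
      fix x :: real
      show "\<forall>\<^sub>F r in at_top. indicator {- r..r} x *\<^sub>R f x = f x"
        using eventually_ge_at_top[of "\<bar>x\<bar>"] by eventually_elim (auto simp: indicator_def)
    qed
    show "\<forall>\<^sub>F r in at_top. AE x in lborel. norm (indicator {-r..r} x *\<^sub>R f x) \<le> norm (f x)"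
      by (auto split: split_indicator)
  qed (use int in auto)
  moreover have "\<forall>\<^sub>F r in at_top. (LINT x|lborel. indicator {-r..r} x *\<^sub>R f x) = F r - F (-r)"
    using eventually_ge_at_top[of 0]
  proof eventually_elim
    fix r :: real assume "0 \<le> r"
    then show "(LINT x|lborel. indicator {-r..r} x *\<^sub>R f x) = F r - F (-r)"
      by (intro integral_FTC_atLeastAtMost has_vector_derivative_at_within[OF F]
           continuous_on_subset[OF cont]) auto
  qed
  ultimately show "((\<lambda>r. F r - F (- r)) \<longlongrightarrow> (LINT x|lborel. f x)) at_top"
    by (rule Lim_transform_eventually)
qed

text \<open>For a primitive \<open>H\<close> of \<open>f\<close>, the function \<open>F x = H (x + i r) - H x\<close> has derivative
  \<open>f (x + i r) - f x\<close> and is bounded by the integral of \<open>\<bar>f\<bar>\<close> over the vertical segment,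
  so that it is integrable and the integral of its derivative vanishes.\<close>

lemma LINT_shift_imaginary:
  assumes hol: "f holomorphic_on UNIV" and r: "0 \<le> r"
    and int: "integrable lborel (\<lambda>x. f (Complex x 0))" "integrable lborel (\<lambda>x. f (Complex x r))"
    and strip: "(\<integral>\<^sup>+ x. \<integral>\<^sup>+ t. ennreal (cmod (f (Complex x t))) * indicator {0..r} t \<partial>lborel \<partial>lborel) < \<infinity>"
  shows "(LINT x|lborel. f (Complex x r)) = (LINT x|lborel. f (Complex x 0))"
proof -
  have cf: "continuous_on UNIV f" using hol by (rule holomorphic_on_imp_continuous_on)
  obtain H where H: "\<And>z. (H has_field_derivative f z) (at z)"
    using holomorphic_convex_primitive'[OF convex_UNIV open_UNIV hol] by auto
  have cH: "continuous_on UNIV H"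
    using H by (meson DERIV_continuous continuous_at_imp_continuous_on)
  define F where "F = (\<lambda>x. H (Complex x r) - H (Complex x 0))"
  have horiz: "((\<lambda>x. H (Complex x t)) has_vector_derivative f (Complex x t)) (at x)" for x t
  proof -
    have "((\<lambda>x. Complex x t) has_vector_derivative 1) (at x)"
      unfolding Complex_eq by (auto intro!: derivative_eq_intros)
    from field_vector_diff_chain_at[OF this H] show ?thesis by (simp add: o_def)
  qed
  have vert: "((\<lambda>t. H (Complex x t)) has_vector_derivative \<i> * f (Complex x t)) (at t)" for x t
  proof -
    have "((\<lambda>t. Complex x t) has_vector_derivative \<i>) (at t)"
      unfolding Complex_eq by (auto intro!: derivative_eq_intros)
    from field_vector_diff_chain_at[OF this H] show ?thesis by (simp add: o_def)
  qed
  have cC: "continuous_on S (\<lambda>x. Complex (g x) (h x))" 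
    if "continuous_on S g" "continuous_on S h" for S and g h :: "real \<Rightarrow> real"
    unfolding Complex_eq by (intro continuous_intros that)
  have cFf: "continuous_on S (\<lambda>x. f (Complex (g x) (h x)))" 
    if "continuous_on S g" "continuous_on S h" for S and g h :: "real \<Rightarrow> real"
    by (rule continuous_on_compose2[OF cf cC[OF that]]) auto
  have F: "(F has_vector_derivative f (Complex x r) - f (Complex x 0)) (at x)" for x
    unfolding F_def by (intro has_vector_derivative_diff horiz)
  have F_le: "ennreal (cmod (F x)) \<le> (\<integral>\<^sup>+ t. ennreal (cmod (f (Complex x t))) * indicator {0..r} t \<partial>lborel)" for x
  proof -
    have "F x = (LINT t|lborel. indicator {0..r} t *\<^sub>R (\<i> * f (Complex x t)))"
      unfolding F_def using r
      by (subst integral_FTC_atLeastAtMost[OF r has_vector_derivative_at_within[OF vert]])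
         (auto intro!: continuous_intros cFf)
    also have "ennreal (cmod \<dots>) \<le> (\<integral>\<^sup>+ t. ennreal (cmod (indicator {0..r} t *\<^sub>R (\<i> * f (Complex x t)))) \<partial>lborel)"
      by (intro integral_norm_bound_ennreal borel_integrable_atLeastAtMost' continuous_intros cFf)
        (auto simp: set_integrable_def[symmetric] intro!: borel_integrable_atLeastAtMost' continuous_intros cFf)
    also have "\<dots> = (\<integral>\<^sup>+ t. ennreal (cmod (f (Complex x t))) * indicator {0..r} t \<partial>lborel)"
      by (intro nn_integral_cong) (auto simp: norm_mult split: split_indicator)
    finally show ?thesis .
  qed
  have intF: "integrable lborel F"
    unfolding integrable_iff_bounded
  proof
    have "continuous_on UNIV F"
      unfolding F_def by (intro continuous_intros continuous_on_compose2[OF cH cC]) auto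
    then show "F \<in> borel_measurable lborel"
      by (simp add: borel_measurable_continuous_onI)
    have "(\<integral>\<^sup>+ x. ennreal (norm (F x)) \<partial>lborel) \<le>
        (\<integral>\<^sup>+ x. \<integral>\<^sup>+ t. ennreal (cmod (f (Complex x t))) * indicator {0..r} t \<partial>lborel \<partial>lborel)"
      by (intro nn_integral_mono F_le)
    then show "(\<integral>\<^sup>+ x. ennreal (norm (F x)) \<partial>lborel) < \<infinity>"
      using strip by (rule le_less_trans)
  qed
  have "(LINT x|lborel. f (Complex x r) - f (Complex x 0)) = 0"
    by (rule LINT_derivative_eq_0[OF F _ intF]) (auto intro!: continuous_intros cFf int)
  then show ?thesis using int by simp
qed

section \<open>From weighted L2 bounds to L1 bounds\<close>

lemma nn_integral_exp_neg_abs: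
  assumes c: "0 < (c :: real)"
  shows "(\<integral>\<^sup>+ x. ennreal (exp (- c * \<bar>x\<bar>)) \<partial>lborel) \<le> ennreal (2 / c)"
proof -
  have half: "(\<integral>\<^sup>+ x. ennreal (exp (- c * x)) * indicator {0..} x \<partial>lborel) = ennreal (1 / c)"
  proof -
    have "((\<lambda>x. - exp (- c * x) / c) \<longlongrightarrow> 0) at_top"
      using c by real_asymp
    then have "(\<integral>\<^sup>+ x. ennreal (exp (- c * x)) * indicator {0..} x \<partial>lborel)
        = ennreal (0 - (- exp (- c * 0) / c))"
      by (intro nn_integral_FTC_atLeast) (use c in \<open>auto intro!: derivative_eq_intros\<close>)
    then show ?thesis by simp
  qed
  \<comment> \<open>The two closed half-lines both contain 0, so the pointwise comparison is an
    inequality.\<close>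
  have "(\<integral>\<^sup>+ x. ennreal (exp (- c * \<bar>x\<bar>)) \<partial>lborel) \<le>
     (\<integral>\<^sup>+ x. ennreal (exp (- c * x)) * indicator {0..} x
           + ennreal (exp (- c * (- x))) * indicator {0..} (- x) \<partial>lborel)"
    by (intro nn_integral_mono) (auto simp: abs_if split: split_indicator)
  also have "\<dots> = ennreal (1 / c) + (\<integral>\<^sup>+ x. ennreal (exp (- c * (- x))) * indicator {0..} (- x :: real) \<partial>lborel)"
    by (subst nn_integral_add, measurable, simp only: half)
  also have "(\<integral>\<^sup>+ x. ennreal (exp (- c * (- x))) * indicator {0..} (- x :: real) \<partial>lborel)
      = (\<integral>\<^sup>+ x. ennreal (exp (- c * x)) * indicator {0..} x \<partial>lborel)"
    by (subst (2) nn_integral_real_affine[where c="-1" and t=0]) auto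
  also have "ennreal (1 / c) + \<dots> = ennreal (2 / c)"
    unfolding half using c by (simp add: ennreal_plus[symmetric] add_divide_distrib[symmetric] del: ennreal_plus)
  finally show ?thesis .
qed

text \<open>It serves twice: with c1 = c2 = 1 for the L1 bound, and with c = \<epsilon> as the
  square of the constant in the Cauchy-Schwarz estimate of
  \<open>cmod_LINT_restr_le\<close>.\<close>

lemma nn_integral_exp_neg_abs2:
  assumes "0 < c1" "0 < c2"
  shows "(\<integral>\<^sup>+ (x1, x2). ennreal (exp (- (4 * pi * (c1 * \<bar>x1\<bar> + c2 * \<bar>x2\<bar>)))) \<partial>(lborel :: (real \<times> real) measure))
     \<le> ennreal (1 / (2 * pi * c1) * (1 / (2 * pi * c2)))"
proof -
  have "(\<integral>\<^sup>+ (x1, x2). ennreal (exp (- (4 * pi * (c1 * \<bar>x1\<bar> + c2 * \<bar>x2\<bar>)))) \<partial>(lborel :: (real \<times> real) measure))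
    = (\<integral>\<^sup>+ x1. \<integral>\<^sup>+ x2. ennreal (exp (- (4 * pi * c1) * \<bar>x1\<bar>)) * ennreal (exp (- (4 * pi * c2) * \<bar>x2\<bar>)) \<partial>lborel \<partial>lborel)"
    unfolding lborel_prod[symmetric]
    by (subst lborel.nn_integral_fst[symmetric])
       (auto intro!: nn_integral_cong simp: ennreal_mult[symmetric] exp_add[symmetric] algebra_simps)
  also have "\<dots> = (\<integral>\<^sup>+ x1. ennreal (exp (- (4 * pi * c1) * \<bar>x1\<bar>)) \<partial>lborel) * 
      (\<integral>\<^sup>+ x2. ennreal (exp (- (4 * pi * c2) * \<bar>x2\<bar>)) \<partial>lborel)"
    by (simp add: nn_integral_cmult nn_integral_multc)
  also have "\<dots> \<le> ennreal (2 / (4 * pi * c1)) * ennreal (2 / (4 * pi * c2))"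
    using assms by (intro mult_mono nn_integral_exp_neg_abs) auto
  also have "\<dots> = ennreal (1 / (2 * pi * c1) * (1 / (2 * pi * c2)))"
    using assms by (subst ennreal_mult[symmetric]) auto
  finally show ?thesis .
qed

text \<open>Pointwise u \<le> u^2 w + 1/w with w = exp(4 pi (|x1| + |x2|)): the first term is
  controlled by the weighted L2 bound, the second is integrable. What matters is that C does not
  depend on the heights y1 and y2, since \<open>AE_strip_finite\<close> integrates over
  them.\<close>

lemma space_A_L1_bound:
  assumes a: "a \<in> space_A" and \<nu>: "0 < \<nu>1" "0 < \<nu>2"
  obtains C where "C < \<infinity>" "\<And>y1 y2. \<bar>y1\<bar> < \<nu>1 \<Longrightarrow> \<bar>y2\<bar> < \<nu>2 \<Longrightarrow>
    (\<integral>\<^sup>+ (x1, x2). ennreal (cmod (a (Complex x1 y1, Complex x2 y2))) \<partial>(lborel :: (real \<times> real) measure)) \<le> C"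
proof -
  obtain A where A: "A < \<infinity>" "\<And>y1 y2. \<bar>y1\<bar> < \<nu>1 \<Longrightarrow> \<bar>y2\<bar> < \<nu>2 \<Longrightarrow> weighted_sq a 1 1 y1 y2 \<le> A"
    using space_A_E[OF a _ _ \<nu>, of 1 1] by auto
  define B where "B = (\<integral>\<^sup>+ (x1, x2). ennreal (exp (- (4 * pi * (1 * \<bar>x1\<bar> + 1 * \<bar>x2\<bar>)))) \<partial>(lborel :: (real \<times> real) measure))"
  have B: "B < \<infinity>"
    using nn_integral_exp_neg_abs2[of 1 1] unfolding B_def by (auto intro: le_less_trans)
  have amgm: "u \<le> u\<^sup>2 * w + 1 / w" if "0 < w" for u w :: real
  proof -
    \<comment> \<open>Expanding gives 2 ((u w)^2 - u w + 1), which is the next inequality up to the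
      factor 2.\<close>
    have "0 \<le> (u * w - 1)\<^sup>2 + (u * w)\<^sup>2 + 1" by simp
    then have "u * w \<le> (u * w)\<^sup>2 + 1" by (simp add: power2_eq_square algebra_simps)
    then show ?thesis using that by (simp add: field_simps power2_eq_square)
  qed
  have "(\<integral>\<^sup>+ (x1, x2). ennreal (cmod (a (Complex x1 y1, Complex x2 y2))) \<partial>(lborel :: (real \<times> real) measure)) \<le> A + B"
    if "\<bar>y1\<bar> < \<nu>1" "\<bar>y2\<bar> < \<nu>2" for y1 y2
  proof -
    have "(\<integral>\<^sup>+ (x1, x2). ennreal (cmod (a (Complex x1 y1, Complex x2 y2))) \<partial>(lborel :: (real \<times> real) measure)) \<le> 
      (\<integral>\<^sup>+ x. (case x of (x1, x2) \<Rightarrow> ennreal ((cmod (a (Complex x1 y1, Complex x2 y2)))\<^sup>2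
        * exp (4 * pi * (1 * \<bar>x1\<bar> + 1 * \<bar>x2\<bar>)))) +
        (case x of (x1, x2) \<Rightarrow> ennreal (exp (- (4 * pi * (1 * \<bar>x1\<bar> + 1 * \<bar>x2\<bar>))))) \<partial>(lborel :: (real \<times> real) measure))"
    proof (rule nn_integral_mono, clarify)
      fix x1 x2 :: real
      define u where "u = cmod (a (Complex x1 y1, Complex x2 y2))"
      define e where "e = 4 * pi * (1 * \<bar>x1\<bar> + 1 * \<bar>x2\<bar>)"
      have "ennreal u \<le> ennreal (u\<^sup>2 * exp e + exp (- e))"
        using amgm[of "exp e" u] by (intro ennreal_leI) (simp add: exp_minus inverse_eq_divide)
      then show "ennreal u \<le> ennreal (u\<^sup>2 * exp e) + ennreal (exp (- e))"
        by simp
    qed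
    also have "\<dots> = weighted_sq a 1 1 y1 y2 + B"
      unfolding weighted_sq_def B_def 
      using measurable_weighted_sq[OF space_A_entire2[OF a], of y1 y2 1 1]
      by (intro nn_integral_add) (auto simp: case_prod_unfold intro!: borel_measurable_continuous_onI continuous_intros)
    also have "\<dots> \<le> A + B" by (intro add_mono A that) simp
    finally show ?thesis .
  qed
  moreover have "A + B < \<infinity>" using A(1) B by simp
  ultimately show ?thesis using that by blast
qed

lemma integrable_space_A:
  assumes a: "a \<in> space_A"
  shows "integrable lborel (\<lambda>(x1, x2). a (Complex x1 y1, Complex x2 y2))"
  unfolding integrable_iff_bounded
proof
  show "(\<lambda>(x1, x2). a (Complex x1 y1, Complex x2 y2)) \<in> borel_measurable lborel"
    by (rule measurable_entire2[OF space_A_entire2[OF a]])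
  obtain C where C: "C < \<infinity>" 
    "(\<integral>\<^sup>+ (x1, x2). ennreal (cmod (a (Complex x1 y1, Complex x2 y2))) \<partial>(lborel :: (real \<times> real) measure)) \<le> C"
    by (rule space_A_L1_bound[OF a, of "\<bar>y1\<bar> + 1" "\<bar>y2\<bar> + 1"]) auto
  then show "(\<integral>\<^sup>+ x. ennreal (norm (case x of (x1, x2) \<Rightarrow> a (Complex x1 y1, Complex x2 y2))) \<partial>lborel) < \<infinity>"
    by (simp add: case_prod_unfold)
qed

section \<open>Contour shifts in two variables\<close>

lemma restr_Complex: "restr a = (\<lambda>(x1, x2). a (Complex x1 0, Complex x2 0))"
  by (simp add: restr_def complex_of_real_def)

lemma integrable_restr: "a \<in> space_A \<Longrightarrow> integrable lborel (restr a)"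
  unfolding restr_Complex by (rule integrable_space_A)

lemma imag_shift_imag_shift: "imag_shift r1 r2 (imag_shift s1 s2 a) = imag_shift (r1 + s1) (r2 + s2) a"
  by (auto simp: imag_shift_def fun_eq_iff algebra_simps)

lemma imag_shift_0: "imag_shift 0 0 a = a"
  by (auto simp: imag_shift_def)

text \<open>This supplies the strip hypothesis of \<open>LINT_shift_imaginary\<close>. Integrated
  over x2 as well, the strip integral becomes, by Tonelli, an integral over heights t in {0..r} of
  the L1 norms at height t, each at most C. A finite integral over x2 has a finite integrand almost
  everywhere.\<close>

lemma AE_strip_finite:
  assumes a: "a \<in> space_A"
  shows "AE x2 in lborel. (\<integral>\<^sup>+ x1. \<integral>\<^sup>+ t. ennreal (cmod (a (Complex x1 t, Complex x2 0))) * indicator {0..r} t \<partial>lborel \<partial>lborel) < \<infinity>"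
proof -
  define f :: "real \<times> real \<Rightarrow> real \<Rightarrow> ennreal" where
    "f = (\<lambda>x t. ennreal (cmod (a (Complex (fst x) t, Complex (snd x) 0))) * indicator {0..r} t)"
  have [measurable]: "case_prod f \<in> borel_measurable (lborel \<Otimes>\<^sub>M lborel)"
  proof -
    have "(\<lambda>p :: (real \<times> real) \<times> real. cmod (a (Complex (fst (fst p)) (snd p), Complex (snd (fst p)) 0))) \<in> borel_measurable borel"
      unfolding Complex_eq
      by (intro borel_measurable_continuous_onI continuous_intros continuous_on_entire2[OF space_A_entire2[OF a]])
    then have [measurable]: "(\<lambda>p :: (real \<times> real) \<times> real. cmod (a (Complex (fst (fst p)) (snd p), Complex (snd (fst p)) 0))) \<in> borel_measurable (lborel \<Otimes>\<^sub>M lborel)"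
      by (simp add: lborel_prod)
    show ?thesis unfolding f_def case_prod_unfold by measurable
  qed
  \<comment> \<open>The bound holds on an open strip; the half-width |r| + 1 makes it contain the
    closed interval {0..r}.\<close>
  obtain C where C: "C < \<infinity>" "\<And>y1 y2. \<bar>y1\<bar> < \<bar>r\<bar> + 1 \<Longrightarrow> \<bar>y2\<bar> < 1 \<Longrightarrow>
    (\<integral>\<^sup>+ (x1, x2). ennreal (cmod (a (Complex x1 y1, Complex x2 y2))) \<partial>(lborel :: (real \<times> real) measure)) \<le> C"
    by (rule space_A_L1_bound[OF a, of "\<bar>r\<bar> + 1" 1]) auto
  have p[measurable]: "(\<lambda>x. \<integral>\<^sup>+ t. f x t \<partial>lborel) \<in> borel_measurable (lborel \<Otimes>\<^sub>M lborel)"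
    unfolding lborel_prod by measurable
  have "(\<integral>\<^sup>+ x2. \<integral>\<^sup>+ x1. (\<integral>\<^sup>+ t. f (x1, x2) t \<partial>lborel) \<partial>lborel \<partial>lborel) = (\<integral>\<^sup>+ x. \<integral>\<^sup>+ t. f x t \<partial>lborel \<partial>lborel)"
    by (subst lborel_pair.nn_integral_snd[OF p]) (simp add: lborel_prod)
  also have "\<dots> = (\<integral>\<^sup>+ t. \<integral>\<^sup>+ x. f x t \<partial>lborel \<partial>lborel)"
    by (rule lborel_pair.Fubini'[symmetric]) measurable
  also have "\<dots> \<le> (\<integral>\<^sup>+ t. C * indicator {0..r} t \<partial>lborel)"
  proof (rule nn_integral_mono)
    fix t :: real
    show "(\<integral>\<^sup>+ x. f x t \<partial>lborel) \<le> C * indicator {0..r} t"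
      using C(2)[of t 0] by (auto simp: f_def case_prod_unfold split: split_indicator)
  qed
  also have "\<dots> < \<infinity>"
    using C(1) by (subst nn_integral_cmult_indicator) (auto simp: ennreal_mult_less_top emeasure_lborel_Icc_eq)
  finally have fin: "(\<integral>\<^sup>+ x2. \<integral>\<^sup>+ x1. (\<integral>\<^sup>+ t. f (x1, x2) t \<partial>lborel) \<partial>lborel \<partial>lborel) \<noteq> \<infinity>" by simp
  have "AE x2 in lborel. (\<integral>\<^sup>+ x1. (\<integral>\<^sup>+ t. f (x1, x2) t \<partial>lborel) \<partial>lborel) \<noteq> \<infinity>"
    by (rule nn_integral_PInf_AE[OF _ fin]) measurable
  then show ?thesis
    by (simp add: f_def less_top)
qed

lemma LINT_restr_imag_shift_fst_nonneg:
  assumes a: "a \<in> space_A" and r: "0 \<le> r"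
  shows "(LINT x|lborel. restr (imag_shift r 0 a) x) = (LINT x|lborel. restr a x)"
proof -
  have Cr: "restr (imag_shift r 0 a) = (\<lambda>(x1, x2). a (Complex x1 r, Complex x2 0))"
    by (auto simp: restr_def imag_shift_def fun_eq_iff Complex_eq)
  have int: "integrable (lborel \<Otimes>\<^sub>M lborel) (\<lambda>(x1, x2). a (Complex x1 y1, Complex x2 y2))" for y1 y2
    using integrable_space_A[OF a] by (simp add: lborel_prod)
  have "(LINT x2|lborel. LINT x1|lborel. a (Complex x1 r, Complex x2 0)) =
        (LINT x2|lborel. LINT x1|lborel. a (Complex x1 0, Complex x2 0))"
  proof (rule integral_cong_AE)
    show "(\<lambda>x2. LINT x1|lborel. a (Complex x1 r, Complex x2 0)) \<in> borel_measurable lborel"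
         "(\<lambda>x2. LINT x1|lborel. a (Complex x1 0, Complex x2 0)) \<in> borel_measurable lborel"
      by (intro borel_measurable_integrable lborel_pair.integrable_snd int)+
    show "AE x2 in lborel. (LINT x1|lborel. a (Complex x1 r, Complex x2 0)) =
        (LINT x1|lborel. a (Complex x1 0, Complex x2 0))"
      \<comment> \<open>Three null sets of x2 are discarded: where the slice at height 0, the slice
        at height r, or the strip between them fails to be integrable.\<close>
      using lborel_pair.AE_integrable_snd[OF int[of 0 0]]
        lborel_pair.AE_integrable_snd[OF int[of r 0]] AE_strip_finite[OF a, of r]
    proof eventually_elim
      fix x2
      assume "integrable lborel (\<lambda>x1. a (Complex x1 0, Complex x2 0))"
        "integrable lborel (\<lambda>x1. a (Complex x1 r, Complex x2 0))"
        "(\<integral>\<^sup>+ x1. \<integral>\<^sup>+ t. ennreal (cmod (a (Complex x1 t, Complex x2 0))) * indicator {0..r} t \<partial>lborel \<partial>lborel) < \<infinity>"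
      then show "(LINT x1|lborel. a (Complex x1 r, Complex x2 0)) = (LINT x1|lborel. a (Complex x1 0, Complex x2 0))"
        by (intro LINT_shift_imaginary[of "\<lambda>z. a (z, Complex x2 0)"] r
            holomorphic_entire2_fst space_A_entire2[OF a])
    qed
  qed
  then show ?thesis
    unfolding Cr restr_Complex[of a]
    by (simp add: lborel_pair.integral_snd[OF int] lborel_prod)
qed

text \<open>For negative r the previous lemma is applied to the shifted function, which returns to
  \<open>a\<close> under the positive shift -r.\<close>

lemma LINT_restr_imag_shift_fst:
  assumes a: "a \<in> space_A"
  shows "(LINT x|lborel. restr (imag_shift r 0 a) x) = (LINT x|lborel. restr a x)"
proof (cases "0 \<le> r")
  case True
  then show ?thesis by (rule LINT_restr_imag_shift_fst_nonneg[OF a])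
next
  case False
  then have "(LINT x|lborel. restr (imag_shift (- r) 0 (imag_shift r 0 a)) x) =
      (LINT x|lborel. restr (imag_shift r 0 a) x)"
    by (intro LINT_restr_imag_shift_fst_nonneg space_A_imag_shift a) simp
  then show ?thesis by (simp add: imag_shift_imag_shift imag_shift_0)
qed

lemma LINT_restr_swap:
  assumes a: "a \<in> space_A"
  shows "(LINT x|lborel. restr (a \<circ> prod.swap) x) = (LINT x|lborel. restr a x)"
proof -
  have "(LINT x|lborel. restr a x) = (LINT x|lborel. restr a (prod.swap x))"
    using borel_measurable_integrable[OF integrable_restr[OF a]]
    by (subst distr_swap_lborel[symmetric], subst integral_distr) auto
  also have "(\<lambda>x. restr a (prod.swap x)) = restr (a \<circ> prod.swap)"
    by (auto simp: restr_def)
  finally show ?thesis ..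
qed

lemma LINT_restr_imag_shift:
  assumes a: "a \<in> space_A"
  shows "(LINT x|lborel. restr (imag_shift r1 r2 a) x) = (LINT x|lborel. restr a x)"
proof -
  \<comment> \<open>Conjugation with \<open>prod.swap\<close> turns a shift of the second coordinate
    into one of the first.\<close>
  define b where "b = imag_shift r2 0 (a \<circ> prod.swap)"
  have b: "b \<in> space_A"
    unfolding b_def by (intro space_A_imag_shift space_A_swap a)
  have "imag_shift r1 r2 a = imag_shift r1 0 (b \<circ> prod.swap)"
    by (auto simp: b_def imag_shift_def)
  then have "(LINT x|lborel. restr (imag_shift r1 r2 a) x) = (LINT x|lborel. restr (b \<circ> prod.swap) x)"
    by (simp add: LINT_restr_imag_shift_fst space_A_swap b)
  also have "\<dots> = (LINT x|lborel. restr a x)"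
    by (simp add: LINT_restr_swap b, simp add: b_def LINT_restr_imag_shift_fst space_A_swap LINT_restr_swap a)
  finally show ?thesis .
qed

subsection \<open>The character\<close>

text \<open>Only four values are prescribed by \<open>chi_values\<close>; those on the inverse
  generators are forced by the relators that make them inverses.\<close>

primrec gen_char :: "real \<Rightarrow> uq_gen \<Rightarrow> complex" where
  "gen_char \<gamma> GenE = 0"
| "gen_char \<gamma> GenF = 0"
| "gen_char \<gamma> GenK1 = qpow \<gamma> (1/2)"
| "gen_char \<gamma> GenK1inv = inverse (qpow \<gamma> (1/2))"
| "gen_char \<gamma> GenK2 = qpow \<gamma> (1/2)"
| "gen_char \<gamma> GenK2inv = inverse (qpow \<gamma> (1/2))"

definition word_char :: "real \<Rightarrow> uq_word \<Rightarrow> complex" where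
  "word_char \<gamma> w = prod_list (map (gen_char \<gamma>) (letters w))"

definition free_char :: "real \<Rightarrow> uq_free \<Rightarrow> complex" where
  "free_char \<gamma> p = (\<Sum>w\<in>Poly_Mapping.keys p. Poly_Mapping.lookup p w * word_char \<gamma> w)"

lemma word_char_add: "word_char \<gamma> (u + v) = word_char \<gamma> u * word_char \<gamma> v"
  by (simp add: word_char_def plus_uq_word_def)

lemma free_char_superset:
  assumes "finite S" "Poly_Mapping.keys p \<subseteq> S"
  shows "free_char \<gamma> p = (\<Sum>w\<in>S. Poly_Mapping.lookup p w * word_char \<gamma> w)"
  unfolding free_char_def
  by (rule sum.mono_neutral_left) (use assms in \<open>auto simp: in_keys_iff\<close>)

lemma free_char_add: "free_char \<gamma> (p + r) = free_char \<gamma> p + free_char \<gamma> r"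
proof -
  let ?S = "Poly_Mapping.keys p \<union> Poly_Mapping.keys r"
  have "Poly_Mapping.keys (p + r) \<subseteq> ?S" by (rule Poly_Mapping.keys_add)
  then show ?thesis
    by (simp add: free_char_superset[of ?S] lookup_add algebra_simps sum.distrib)
qed

lemma free_char_zero [simp]: "free_char \<gamma> 0 = 0"
  by (simp add: free_char_def)

lemma free_char_uminus: "free_char \<gamma> (- p) = - free_char \<gamma> p"
  using free_char_add[of \<gamma> "- p" p] by (simp add: eq_neg_iff_add_eq_0)

lemma free_char_diff: "free_char \<gamma> (p - r) = free_char \<gamma> p - free_char \<gamma> r"
  using free_char_add[of \<gamma> p "- r"] by (simp add: free_char_uminus)

lemma free_char_single: "free_char \<gamma> (Poly_Mapping.single w c) = c * word_char \<gamma> w"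
  by (simp add: free_char_def)

lemma free_char_mult: "free_char \<gamma> (p * r) = free_char \<gamma> p * free_char \<gamma> r"
proof (induction p rule: uq_free_induct)
  case (single w c)
  show ?case
    by (induction r rule: uq_free_induct)
      (auto simp: mult_single free_char_single word_char_add distrib_left free_char_add)
qed (auto simp: free_char_add distrib_right)

lemma free_char_one [simp]: "free_char \<gamma> 1 = 1"
  by (simp add: single_one[symmetric] free_char_single word_char_def zero_uq_word_def del: single_one)

lemma free_char_gen [simp]: "free_char \<gamma> (gen g) = gen_char \<gamma> g"
  by (simp add: gen_def free_char_single word_char_def)

lemma free_char_scal [simp]: "free_char \<gamma> (scal c) = c"
  by (simp add: scal_def free_char_single word_char_def zero_uq_word_def)

text \<open>In the relators with E or F, every product containing one of these vanishes. What
  remains of the last relator is the K part, and K = K1 K2^(-1) has value q^(1/2) q^(-1/2) = 1, so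
  K^2 - K^(-2) is sent to 0.\<close>

lemma free_char_relator: "p \<in> uq_relators \<gamma> \<Longrightarrow> free_char \<gamma> p = 0"
  unfolding uq_relators_def
  by (elim insertE emptyE) (simp_all add: free_char_diff free_char_mult power2_eq_square)

text \<open>The kernel of the multiplicative functional \<open>free_char\<close> is a two-sided
  ideal containing the relators, hence contains the ideal they generate.\<close>

lemma free_char_ideal:
  assumes p: "p \<in> uq_ideal \<gamma>"
  shows "free_char \<gamma> p = 0"
proof -
  interpret ring uq_free_ring by (rule uq_free_ring)
  let ?I = "{p. free_char \<gamma> p = 0}"
  have "ideal ?I uq_free_ring"
  proof (rule idealI)
    show "subgroup ?I (add_monoid uq_free_ring)"
    proof (rule add.subgroupI)
      show "?I \<noteq> {}" by (auto intro!: exI[of _ 0])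
    next
      fix p assume "p \<in> ?I"
      then show "\<ominus>\<^bsub>uq_free_ring\<^esub> p \<in> ?I"
        by (simp add: uq_free_uminus free_char_uminus)
    qed (auto simp: free_char_add ring_of_type_algebra_def)
  qed (rule uq_free_ring, auto simp: ring_of_type_algebra_def free_char_mult)
  then have "uq_ideal \<gamma> \<subseteq> ?I"
    unfolding uq_ideal_def by (rule genideal_minimal) (auto simp: free_char_relator)
  then show ?thesis using p by blast
qed

section \<open>Descent to the quotient and uniqueness of the character\<close>

lemma uq_ideal_add: "p \<in> uq_ideal \<gamma> \<Longrightarrow> r \<in> uq_ideal \<gamma> \<Longrightarrow> p + r \<in> uq_ideal \<gamma>"
  using additive_subgroup.a_closed[OF ideal.axioms(1)[OF uq_ideal]]
  by (simp add: ring_of_type_algebra_def)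

lemma uq_ideal_uminus: "p \<in> uq_ideal \<gamma> \<Longrightarrow> - p \<in> uq_ideal \<gamma>"
  using additive_subgroup.a_inv_closed[OF ideal.axioms(1)[OF uq_ideal]]
  by (simp add: uq_free_uminus)

lemma uq_class_eqI:
  assumes "p - r \<in> uq_ideal \<gamma>"
  shows "uq_class \<gamma> p = uq_class \<gamma> r"
proof (rule Set.set_eqI)
  fix x
  have "x - r \<in> uq_ideal \<gamma>" if "x - p \<in> uq_ideal \<gamma>"
    using uq_ideal_add[OF that assms] by simp
  moreover have "x - p \<in> uq_ideal \<gamma>" if "x - r \<in> uq_ideal \<gamma>"
    using uq_ideal_add[OF that uq_ideal_uminus[OF assms]] by simp
  ultimately show "x \<in> uq_class \<gamma> p \<longleftrightarrow> x \<in> uq_class \<gamma> r"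
    unfolding in_uq_class_iff by blast
qed

lemma uq_relators_subset_ideal: "uq_relators \<gamma> \<subseteq> uq_ideal \<gamma>"
  unfolding uq_ideal_def
  by (rule ring.genideal_self[OF uq_free_ring]) (simp add: ring_of_type_algebra_def)

lemma uq_class_in_carrier: "uq_class \<gamma> p \<in> carrier (Uq \<gamma>)"
  by (simp add: uq_carrier)

lemma one_Uq: "\<one>\<^bsub>Uq \<gamma>\<^esub> = uq_class \<gamma> 1"
  by (simp add: Uq_def FactRing_def uq_class_def ring_of_type_algebra_def)

text \<open>The restriction to the carrier fixes the value on sets that are not cosets, as
  uniqueness among HOL functions demands. The chosen representative is irrelevant by
  \<open>uq_char_class\<close>.\<close>

definition uq_char :: "real \<Rightarrow> uq_free set \<Rightarrow> complex" where
  "uq_char \<gamma> = (\<lambda>f\<in>carrier (Uq \<gamma>). free_char \<gamma> (SOME p. p \<in> f))"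

lemma uq_char_class: "uq_char \<gamma> (uq_class \<gamma> p) = free_char \<gamma> p"
proof -
  have "0 \<in> uq_ideal \<gamma>"
    using additive_subgroup.zero_closed[OF ideal.axioms(1)[OF uq_ideal]]
    by (simp add: ring_of_type_algebra_def)
  then have "p \<in> uq_class \<gamma> p"
    by (simp add: in_uq_class_iff)
  then have "(SOME r. r \<in> uq_class \<gamma> p) \<in> uq_class \<gamma> p" by (rule someI)
  then have "(SOME r. r \<in> uq_class \<gamma> p) - p \<in> uq_ideal \<gamma>" by (simp add: in_uq_class_iff)
  from free_char_ideal[OF this] show ?thesis
    by (simp add: uq_char_def uq_class_in_carrier free_char_diff)
qed

lemma uq_character_uq_char: "uq_character \<gamma> (uq_char \<gamma>)"
proof -
  have "uq_char \<gamma> \<in> ring_hom (Uq \<gamma>) ring_of_type_algebra"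
    by (rule ring_hom_memI)
      (auto simp: ring_of_type_algebra_def uq_carrier uq_class_mult uq_class_add
        uq_char_class free_char_mult free_char_add one_Uq)
  then show ?thesis by (simp add: uq_character_def uq_char_class)
qed

lemma chi_values_uq_char: "chi_values \<gamma> (uq_char \<gamma>)"
  by (simp add: chi_values_def uq_char_class)

text \<open>A character is determined by its values on generators: the relators give the values on
  the inverse generators, multiplicativity those on words, and \<open>uq_character\<close> fixes the
  scalars.\<close>

lemma uq_character_class:
  assumes chi: "uq_character \<gamma> chi" "chi_values \<gamma> chi"
  shows "chi (uq_class \<gamma> p) = free_char \<gamma> p"
proof -
  have hom: "chi \<in> ring_hom (Uq \<gamma>) ring_of_type_algebra" 
    and scal: "chi (uq_class \<gamma> (scal c)) = c" for c
    using chi by (auto simp: uq_character_def)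
  have plus: "chi (uq_class \<gamma> (p + r)) = chi (uq_class \<gamma> p) + chi (uq_class \<gamma> r)" for p r
    using ring_hom_add[OF hom uq_class_in_carrier uq_class_in_carrier, of p r]
    by (simp add: uq_class_add) (simp add: ring_of_type_algebra_def)
  have mult: "chi (uq_class \<gamma> (p * r)) = chi (uq_class \<gamma> p) * chi (uq_class \<gamma> r)" for p r
    using ring_hom_mult[OF hom uq_class_in_carrier uq_class_in_carrier, of p r]
    by (simp add: uq_class_mult) (simp add: ring_of_type_algebra_def)
  have one: "chi (uq_class \<gamma> 1) = 1"
    using scal[of 1] by (simp add: scal_def)
  have inv: "chi (uq_class \<gamma> r) = inverse (chi (uq_class \<gamma> p))" if "p * r - 1 \<in> uq_relators \<gamma>" for p r
  proof -
    have "uq_class \<gamma> (p * r) = uq_class \<gamma> 1"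
      using that uq_relators_subset_ideal by (intro uq_class_eqI) blast
    then have "chi (uq_class \<gamma> p) * chi (uq_class \<gamma> r) = 1"
      by (simp add: mult[symmetric] one)
    then show ?thesis by (metis inverse_unique)
  qed
  have "gen GenK1 * gen GenK1inv - 1 \<in> uq_relators \<gamma>" "gen GenK2 * gen GenK2inv - 1 \<in> uq_relators \<gamma>"
    by (simp_all add: uq_relators_def)
  note K = inv[OF this(1)] inv[OF this(2)]
  have gen: "chi (uq_class \<gamma> (gen g)) = gen_char \<gamma> g" for g
    using chi(2) K by (cases g) (simp_all add: chi_values_def)
  show ?thesis
  proof (induction p rule: uq_free_induct)
    case zero
    then show ?case using scal[of 0] by (simp add: scal_def)
  next
    case (add p r)
    then show ?case by (simp add: plus free_char_add)
  next
    case (single w c)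
    obtain gs where w: "w = Word gs" by (cases w)
    have "chi (uq_class \<gamma> (Poly_Mapping.single (Word gs) c)) = free_char \<gamma> (Poly_Mapping.single (Word gs) c)"
    proof (induction gs)
      case Nil
      show ?case using scal[of c] free_char_scal[of \<gamma> c] by (simp add: scal_def zero_uq_word_def)
    next
      case (Cons g gs)
      \<comment> \<open>The scalar stays with the remaining word, so the induction ends at a
        scalar.\<close>
      have "Poly_Mapping.single (Word (g # gs)) c = gen g * Poly_Mapping.single (Word gs) c"
        by (simp add: gen_def mult_single plus_uq_word_def)
      then show ?case by (simp add: mult gen free_char_mult Cons)
    qed
    then show ?case by (simp add: w)
  qed
qed

lemma ex1_uq_character:
  "\<exists>!chi. chi \<in> extensional (carrier (Uq \<gamma>)) \<and> uq_character \<gamma> chi \<and> chi_values \<gamma> chi"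
proof (rule ex1I[of _ "uq_char \<gamma>"])
  show "uq_char \<gamma> \<in> extensional (carrier (Uq \<gamma>)) \<and> uq_character \<gamma> (uq_char \<gamma>) \<and> chi_values \<gamma> (uq_char \<gamma>)"
    by (simp add: uq_character_uq_char chi_values_uq_char) (simp add: uq_char_def)
next
  fix chi
  assume chi: "chi \<in> extensional (carrier (Uq \<gamma>)) \<and> uq_character \<gamma> chi \<and> chi_values \<gamma> chi"
  show "chi = uq_char \<gamma>"
  proof (rule extensionalityI[of _ "carrier (Uq \<gamma>)"])
    fix f assume "f \<in> carrier (Uq \<gamma>)"
    then show "chi f = uq_char \<gamma> f"
      using chi by (auto simp: uq_carrier uq_char_class uq_character_class)
  qed (use chi in \<open>auto simp: uq_char_def\<close>)
qed

subsection \<open>Covariance\<close>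

lemma exp_mult_exp_mult: "exp_mult p q (exp_mult r s a) = exp_mult (p + r) (q + s) a"
  by (auto simp: exp_mult_def fun_eq_iff exp_add algebra_simps)

lemma exp_mult_lin:
  "exp_mult p q (\<lambda>z. c * a z + d * b z) = (\<lambda>z. c * exp_mult p q a z + d * exp_mult p q b z)"
  by (auto simp: exp_mult_def fun_eq_iff algebra_simps)

lemma exp_Q_restr: "exp_Q (c1, c2) (restr a) = restr (exp_mult (2 * pi * c1) (2 * pi * c2) a)"
  by (auto simp: exp_Q_def restr_def exp_mult_def fun_eq_iff exp_of_real[symmetric] algebra_simps)

lemma h_integrand_restr:
  "h_integrand \<alpha> \<beta> (k1, k2) a
     = restr (exp_mult (2 * pi * alpha_k \<alpha> \<beta> k1) (2 * pi * beta_k \<alpha> \<beta> k2) a)"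
  by (auto simp: h_integrand_def restr_def exp_mult_def fun_eq_iff exp_of_real[symmetric] algebra_simps)

lemma h_fun_restr:
  "h_fun \<alpha> \<beta> (k1, k2) a
     = (LINT x|lborel. restr (exp_mult (2 * pi * alpha_k \<alpha> \<beta> k1) (2 * pi * beta_k \<alpha> \<beta> k2) a) x)"
  by (simp add: h_fun_def h_integrand_restr)

lemma integrable_h_integrand:
  "a \<in> space_A \<Longrightarrow> integrable lborel (h_integrand \<alpha> \<beta> (k1, k2) a)"
  unfolding h_integrand_restr by (intro integrable_restr space_A_exp_mult)

lemma h_fun_lin:
  assumes "a \<in> space_A" "b \<in> space_A"
  shows "h_fun \<alpha> \<beta> (k1, k2) (\<lambda>z. c * a z + d * b z) =
     c * h_fun \<alpha> \<beta> (k1, k2) a + d * h_fun \<alpha> \<beta> (k1, k2) b"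
proof -
  have "h_integrand \<alpha> \<beta> (k1, k2) (\<lambda>z. c * a z + d * b z) =
     (\<lambda>x. c * h_integrand \<alpha> \<beta> (k1, k2) a x + d * h_integrand \<alpha> \<beta> (k1, k2) b x)"
    by (auto simp: h_integrand_def fun_eq_iff algebra_simps)
  then show ?thesis
    using integrable_h_integrand[OF assms(1)] integrable_h_integrand[OF assms(2)]
    by (simp add: h_fun_def)
qed

text \<open>Writing e^(p z) = e^(-i p r) e^(p (z + i r)) in each variable makes the integrand a
  constant times an imaginary shift of \<open>exp_mult p q a\<close>, and that shift leaves the
  integral unchanged.\<close>

lemma LINT_exp_mult_imag_shift:
  assumes a: "a \<in> space_A"
  shows "(LINT x|lborel. restr (exp_mult p q (imag_shift r1 r2 a)) x) =
    exp (- \<i> * complex_of_real (p * r1 + q * r2)) * (LINT x|lborel. restr (exp_mult p q a) x)"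
proof -
  have e: "exp (complex_of_real p * z1 + complex_of_real q * z2) =
      exp (- \<i> * complex_of_real (p * r1 + q * r2)) *
      exp (complex_of_real p * (z1 + \<i> * complex_of_real r1) + complex_of_real q * (z2 + \<i> * complex_of_real r2))"
    for z1 z2
    by (subst exp_add[symmetric], rule arg_cong[of _ _ exp]) (simp add: algebra_simps)
  have "exp_mult p q (imag_shift r1 r2 a) =
      (\<lambda>z. exp (- \<i> * complex_of_real (p * r1 + q * r2)) * imag_shift r1 r2 (exp_mult p q a) z)"
    unfolding exp_mult_def imag_shift_def case_prod_unfold
    by (rule ext, subst e) (simp only: fst_conv snd_conv mult.assoc)
  then have "restr (exp_mult p q (imag_shift r1 r2 a)) =
      (\<lambda>x. exp (- \<i> * complex_of_real (p * r1 + q * r2)) * restr (imag_shift r1 r2 (exp_mult p q a)) x)"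
    by (auto simp: restr_def)
  then show ?thesis
    by (simp add: LINT_restr_imag_shift space_A_exp_mult a)
qed

text \<open>In this normal form both the closure of \<open>space_A\<close> and the effect on the
  integral follow from the facts on shifts, exponentials and sums. The differences are written c u +
  (-c) v to match \<open>space_A_lin\<close>.\<close>

lemma gen_act_exp_mult_imag_shift:
  "gen_act \<gamma> \<alpha> \<beta> GenE a = exp_mult (- 2 * pi * \<alpha>) (2 * pi * \<beta>)
     (\<lambda>z. inverse (lam \<gamma>) * imag_shift \<beta> 0 a z + - inverse (lam \<gamma>) * imag_shift (- \<beta>) 0 a z)"
  "gen_act \<gamma> \<alpha> \<beta> GenF a = exp_mult (2 * pi * \<alpha>) (- 2 * pi * \<beta>)
     (\<lambda>z. inverse (lam \<gamma>) * imag_shift 0 \<alpha> a z + - inverse (lam \<gamma>) * imag_shift 0 (- \<alpha>) a z)"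
  "gen_act \<gamma> \<alpha> \<beta> GenK1 a = imag_shift (- \<beta> / 2) 0 a"
  "gen_act \<gamma> \<alpha> \<beta> GenK1inv a = imag_shift (\<beta> / 2) 0 a"
  "gen_act \<gamma> \<alpha> \<beta> GenK2 a = imag_shift 0 (- \<alpha> / 2) a"
  "gen_act \<gamma> \<alpha> \<beta> GenK2inv a = imag_shift 0 (\<alpha> / 2) a"
  by (simp_all add: exp_mult_def imag_shift_def case_prod_unfold algebra_simps)

lemma gen_act_space_A: "a \<in> space_A \<Longrightarrow> gen_act \<gamma> \<alpha> \<beta> g a \<in> space_A"
  by (cases g; simp only: gen_act_exp_mult_imag_shift)
    (intro space_A_exp_mult space_A_lin space_A_imag_shift; assumption)+

lemma h_fun_gen_act:
  assumes ab: "\<alpha> * \<beta> = \<gamma>" and nz: "\<alpha> \<noteq> 0" "\<beta> \<noteq> 0" and a: "a \<in> space_A"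
  shows "h_fun \<alpha> \<beta> (k1, k2) (gen_act \<gamma> \<alpha> \<beta> g a) = gen_char \<gamma> g * h_fun \<alpha> \<beta> (k1, k2) a"
proof -
  \<comment> \<open>The exponents are kept general because the prefactors of E and F change those of
    \<open>h_fun\<close>.\<close>
  define I where "I = (\<lambda>p q a. LINT x|lborel. restr (exp_mult p q a) x)"
  have shift: "I p q (imag_shift r1 r2 a) = exp (- \<i> * complex_of_real (p * r1 + q * r2)) * I p q a" for p q r1 r2
    unfolding I_def by (rule LINT_exp_mult_imag_shift[OF a])
  have lin: "I p q (exp_mult r s (\<lambda>z. c * imag_shift u v a z + - c * imag_shift u' v' a z)) = 
    c * (I (p + r) (q + s) (imag_shift u v a) - I (p + r) (q + s) (imag_shift u' v' a))" for p q r s c u v u' v'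
  proof -
    have int: "integrable lborel (restr (exp_mult (p + r) (q + s) (imag_shift u v a)))" for u v
      by (intro integrable_restr space_A_exp_mult space_A_imag_shift a)
    show ?thesis
      using int[of u v] int[of u' v']
      unfolding I_def exp_mult_exp_mult exp_mult_lin
      by (simp add: restr_def case_prod_unfold algebra_simps)
  qed
  define P Q where "P = 2 * pi * alpha_k \<alpha> \<beta> k1" and "Q = 2 * pi * beta_k \<alpha> \<beta> k2"
  have h: "h_fun \<alpha> \<beta> (k1, k2) b = I P Q b" for b
    by (simp add: h_fun_restr I_def P_def Q_def)
  \<comment> \<open>All phases below are computed from these two products.\<close>
  have PQ: "P * \<beta> = 2 * pi * (\<gamma> + 2 * k1)" "Q * \<alpha> = 2 * pi * (\<gamma> + 2 * k2)"
    using nz ab by (simp_all add: P_def Q_def alpha_k_def beta_k_def field_simps)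
  have one: "exp (- \<i> * complex_of_real (4 * pi * of_int k)) = 1" for k :: int
  proof -
    have "exp (- \<i> * complex_of_real (4 * pi * of_int k)) = exp (complex_of_real (2 * of_int (- 2 * k) * pi) * \<i>)"
      by (simp add: algebra_simps)
    also have "\<dots> = 1" by (rule exp_integer_2pi) simp
    finally show ?thesis .
  qed
  \<comment> \<open>A half step turns the summand 2 k into a full period 2 pi k and leaves
    q^(1/2).\<close>
  have half: "exp (- \<i> * complex_of_real (- (pi * (\<gamma> + 2 * of_int k)))) = qpow \<gamma> (1/2)" for k :: int
  proof -
    have "exp (- \<i> * complex_of_real (- (pi * (\<gamma> + 2 * of_int k)))) =
        qpow \<gamma> (1/2) * exp (complex_of_real (2 * of_int k * pi) * \<i>)"
      unfolding qpow_def by (subst exp_add[symmetric], rule arg_cong[of _ _ exp]) (simp add: algebra_simps)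
    also have "exp (complex_of_real (2 * of_int k * pi) * \<i>) = 1" by (rule exp_integer_2pi) simp
    finally show ?thesis by simp
  qed
  have half': "exp (- \<i> * complex_of_real (pi * (\<gamma> + 2 * of_int k))) = inverse (qpow \<gamma> (1/2))" for k :: int
    unfolding half[of k, symmetric] by (simp add: exp_minus[symmetric])
  show ?thesis
  proof (cases g)
    case GenE
    \<comment> \<open>The prefactor cancels \<gamma> = \<alpha>\<beta>, leaving an integer multiple
      of 4 pi; both phases are 1 and the difference vanishes.\<close>
    have "(P + - 2 * pi * \<alpha>) * \<beta> + (Q + 2 * pi * \<beta>) * 0 = 4 * pi * of_int k1"
      "(P + - 2 * pi * \<alpha>) * - \<beta> + (Q + 2 * pi * \<beta>) * 0 = 4 * pi * of_int (- k1)"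
      using PQ ab by (auto simp: algebra_simps)
    then show ?thesis
      by (simp only: GenE h gen_act_exp_mult_imag_shift lin shift one gen_char.simps) simp
  next
    case GenF
    have "(P + 2 * pi * \<alpha>) * 0 + (Q + - 2 * pi * \<beta>) * \<alpha> = 4 * pi * of_int k2"
      "(P + 2 * pi * \<alpha>) * 0 + (Q + - 2 * pi * \<beta>) * - \<alpha> = 4 * pi * of_int (- k2)"
      using PQ ab by (auto simp: algebra_simps)
    then show ?thesis
      by (simp only: GenF h gen_act_exp_mult_imag_shift lin shift one gen_char.simps) simp
  next
    case GenK1
    have "P * (- \<beta> / 2) + Q * 0 = - (pi * (\<gamma> + 2 * of_int k1))" using PQ by simp
    then show ?thesis
      by (simp only: GenK1 h gen_act_exp_mult_imag_shift shift half gen_char.simps)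
  next
    case GenK1inv
    have "P * (\<beta> / 2) + Q * 0 = pi * (\<gamma> + 2 * of_int k1)" using PQ by simp
    then show ?thesis
      by (simp only: GenK1inv h gen_act_exp_mult_imag_shift shift half' gen_char.simps)
  next
    case GenK2
    have "P * 0 + Q * (- \<alpha> / 2) = - (pi * (\<gamma> + 2 * of_int k2))" using PQ by simp
    then show ?thesis
      by (simp only: GenK2 h gen_act_exp_mult_imag_shift shift half gen_char.simps)
  next
    case GenK2inv
    have "P * 0 + Q * (\<alpha> / 2) = pi * (\<gamma> + 2 * of_int k2)" using PQ by simp
    then show ?thesis
      by (simp only: GenK2inv h gen_act_exp_mult_imag_shift shift half' gen_char.simps)
  qed
qed

text \<open>Membership and formula are proved together: applying one more generator requires that
  the function obtained so far lies in \<open>space_A\<close>.\<close>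

lemma free_act_space_A_h_fun:
  assumes ab: "\<alpha> * \<beta> = \<gamma>" and nz: "\<alpha> \<noteq> 0" "\<beta> \<noteq> 0" and a: "a \<in> space_A"
  shows "free_act \<gamma> \<alpha> \<beta> p a \<in> space_A \<and>
    h_fun \<alpha> \<beta> (k1, k2) (free_act \<gamma> \<alpha> \<beta> p a) = free_char \<gamma> p * h_fun \<alpha> \<beta> (k1, k2) a"
proof (induction p rule: uq_free_induct)
  case zero
  \<comment> \<open>As a trivial linear combination of \<open>a\<close>, the zero function falls
    under the linearity lemmas.\<close>
  have "free_act \<gamma> \<alpha> \<beta> 0 a = (\<lambda>z. 0 * a z + 0 * a z)" by (simp add: fun_eq_iff)
  then show ?case
    by (simp only: space_A_lin[OF a a] h_fun_lin[OF a a]) simp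
next
  case (add p r)
  have eq: "free_act \<gamma> \<alpha> \<beta> (p + r) a = (\<lambda>z. 1 * free_act \<gamma> \<alpha> \<beta> p a z + 1 * free_act \<gamma> \<alpha> \<beta> r a z)"
    by (simp add: fun_eq_iff free_act_add)
  show ?case
    unfolding eq using add 
    by (simp only: space_A_lin h_fun_lin) (simp add: free_char_add algebra_simps)
next
  case (single w c)
  obtain gs where w: "w = Word gs" by (cases w)
  have "free_act \<gamma> \<alpha> \<beta> (Poly_Mapping.single (Word gs) c) a \<in> space_A \<and>
    h_fun \<alpha> \<beta> (k1, k2) (free_act \<gamma> \<alpha> \<beta> (Poly_Mapping.single (Word gs) c) a)
      = free_char \<gamma> (Poly_Mapping.single (Word gs) c) * h_fun \<alpha> \<beta> (k1, k2) a"
  proof (induction gs)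
    case Nil
    have "free_act \<gamma> \<alpha> \<beta> (Poly_Mapping.single (Word []) c) a = (\<lambda>z. c * a z + 0 * a z)"
      by (simp add: fun_eq_iff free_act_single word_act_def)
    then show ?case
      by (simp only: space_A_lin[OF a a] h_fun_lin[OF a a])
         (simp add: free_char_single word_char_def)
  next
    case (Cons g gs)
    have "Poly_Mapping.single (Word (g # gs)) c = gen g * Poly_Mapping.single (Word gs) c"
      by (simp add: gen_def mult_single plus_uq_word_def)
    then show ?case
      using Cons by (simp add: free_act_mult free_act_gen gen_act_space_A h_fun_gen_act[OF ab nz] free_char_mult)
  qed
  then show ?case by (simp add: w)
qed

lemma h_fun_uq_act:
  assumes ab: "\<alpha> * \<beta> = \<gamma>" and q: "qpow \<gamma> 1 \<noteq> 1" "qpow \<gamma> 1 \<noteq> -1" 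
    and chi: "uq_character \<gamma> chi" "chi_values \<gamma> chi"
    and f: "f \<in> carrier (Uq \<gamma>)" and a: "a \<in> space_A"
  shows "h_fun \<alpha> \<beta> (k1, k2) (uq_act \<gamma> \<alpha> \<beta> f a) = chi f * h_fun \<alpha> \<beta> (k1, k2) a"
proof -
  \<comment> \<open>If \<alpha> or \<beta> were 0, then \<gamma> = 0 and q = 1.\<close>
  have nz: "\<alpha> \<noteq> 0" "\<beta> \<noteq> 0"
    using q ab by (auto simp: qpow_def)
  show ?thesis
    using f by (auto simp: uq_carrier uq_act_class[OF q ab] uq_character_class[OF chi]
        free_act_space_A_h_fun[OF ab nz a])
qed

section \<open>Real translations\<close>

lemma h_fun_real_shift:
  assumes ab: "\<alpha> * \<beta> = \<gamma>" and nz: "\<alpha> \<noteq> 0" "\<beta> \<noteq> 0" and a: "a \<in> space_A"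
  shows "h_fun \<alpha> \<beta> (k1, k2)
          (\<lambda>(z1, z2). a (z1 + complex_of_real (\<beta> * s), z2 + complex_of_real (\<alpha> * t)))
        = complex_of_real (exp (- 2 * pi * \<gamma> * (s + t) - 4 * pi * (k1 * s + k2 * t)))
          * h_fun \<alpha> \<beta> (k1, k2) a" (is "h_fun _ _ _ ?b = ?e * _")
proof -
  define F where "F = h_integrand \<alpha> \<beta> (k1, k2) a"
  have F: "F \<in> borel_measurable borel"
    using borel_measurable_integrable[OF integrable_h_integrand[OF a]] by (simp add: F_def)
  have k: "alpha_k \<alpha> \<beta> k1 * \<beta> = \<gamma> + 2 * k1" "beta_k \<alpha> \<beta> k2 * \<alpha> = \<gamma> + 2 * k2"
    using nz ab by (simp_all add: alpha_k_def beta_k_def field_simps)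
  have "h_integrand \<alpha> \<beta> (k1, k2) ?b x = ?e * F ((\<beta> * s, \<alpha> * t) + x)" for x
  proof -
    obtain x1 x2 where x: "x = (x1, x2)" by (cases x)
    define A B where "A = alpha_k \<alpha> \<beta> k1" and "B = beta_k \<alpha> \<beta> k2"
    \<comment> \<open>The terms (A \<beta>) s and (B \<alpha>) t complete the exponent to the one at
      the translated point; by \<open>k\<close> they are compensated exactly by the exponent of the
      claimed factor.\<close>
    have "2 * pi * (A * x1 + B * x2) = (- 2 * pi * \<gamma> * (s + t) - 4 * pi * (k1 * s + k2 * t))
       + 2 * pi * ((A * \<beta>) * s + A * x1 + ((B * \<alpha>) * t + B * x2))"
      unfolding k[folded A_def B_def] by (simp add: algebra_simps)
    also have "\<dots> = (- 2 * pi * \<gamma> * (s + t) - 4 * pi * (k1 * s + k2 * t)) + 2 * pi * (A * (\<beta> * s + x1) + B * (\<alpha> * t + x2))"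
      by (simp add: algebra_simps)
    finally have "exp (2 * pi * (A * x1 + B * x2)) = exp (- 2 * pi * \<gamma> * (s + t) - 4 * pi * (k1 * s + k2 * t))
        * exp (2 * pi * (A * (\<beta> * s + x1) + B * (\<alpha> * t + x2)))"
      by (simp only: exp_add)
    then show ?thesis
      by (simp only: F_def x h_integrand_def prod.case add_Pair A_def B_def of_real_mult) (simp add: add.commute)
  qed
  then have "h_fun \<alpha> \<beta> (k1, k2) ?b = ?e * (LINT x|lborel. F ((\<beta> * s, \<alpha> * t) + x))"
    by (simp add: h_fun_def)
  also have "(LINT x|lborel. F ((\<beta> * s, \<alpha> * t) + x)) = (LINT x|distr lborel borel ((+) (\<beta> * s, \<alpha> * t)). F x)"
    using F by (subst integral_distr) auto
  also have "\<dots> = h_fun \<alpha> \<beta> (k1, k2) a"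
    by (simp only: lborel_distr_plus) (simp add: h_fun_def F_def)
  finally show ?thesis .
qed

subsection \<open>Continuity\<close>

text \<open>The weights in \<open>space_A\<close> have strictly positive exponents, so the
  unweighted integral is compared with the one for \<mu>1 = \<mu>2 = 1 at height 0, whose weight is
  at least 1.\<close>

lemma integrable_restr_sq:
  assumes a: "a \<in> space_A"
  shows "integrable lborel (\<lambda>x. (cmod (restr a x))\<^sup>2)"
  unfolding integrable_iff_bounded
proof
  have [measurable]: "restr a \<in> borel_measurable borel"
    using borel_measurable_integrable[OF integrable_restr[OF a]] by simp
  show "(\<lambda>x. (cmod (restr a x))\<^sup>2) \<in> borel_measurable lborel" by measurable
  obtain C where C: "C < \<infinity>" "\<And>y1 y2. \<bar>y1\<bar> < 1 \<Longrightarrow> \<bar>y2\<bar> < 1 \<Longrightarrow> weighted_sq a 1 1 y1 y2 \<le> C"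
    using space_A_E[OF a, of 1 1 1 1] by auto
  have "(\<integral>\<^sup>+ x. ennreal (norm ((cmod (restr a x))\<^sup>2)) \<partial>lborel) \<le> weighted_sq a 1 1 0 0"
    unfolding weighted_sq_def restr_Complex
    by (intro nn_integral_mono) (auto intro!: ennreal_leI mult_le_cancel_left1[THEN iffD2])
  also have "\<dots> \<le> C" by (rule C(2)) auto
  finally show "(\<integral>\<^sup>+ x. ennreal (norm ((cmod (restr a x))\<^sup>2)) \<partial>lborel) < \<infinity>"
    using C(1) by (rule le_less_trans)
qed

text \<open>Expanding the product gives four exponentials; the factors 1 put their sum into the form
  to which \<open>space_A_lin\<close> applies.\<close>

lemma S_exp_Q_restr:
  "S_exp_Q (\<epsilon>1, \<epsilon>2) (restr a) = restr (\<lambda>z.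
     1 * (1 * exp_mult (2 * pi * \<epsilon>1) (2 * pi * \<epsilon>2) a z + 1 * exp_mult (2 * pi * \<epsilon>1) (- 2 * pi * \<epsilon>2) a z) +
     1 * (1 * exp_mult (- 2 * pi * \<epsilon>1) (2 * pi * \<epsilon>2) a z + 1 * exp_mult (- 2 * pi * \<epsilon>1) (- 2 * pi * \<epsilon>2) a z))"
  by (auto simp: S_exp_Q_def restr_def exp_mult_def fun_eq_iff exp_of_real[symmetric] exp_add exp_diff
      exp_minus divide_inverse algebra_simps)

lemma S_exp_Q_restr_space_A:
  assumes "a \<in> space_A"
  obtains b where "b \<in> space_A" "S_exp_Q (\<epsilon>1, \<epsilon>2) (restr a) = restr b"
  by (rule that[OF _ S_exp_Q_restr]) (intro space_A_lin space_A_exp_mult assms)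

lemma l2_norm_nonneg: "0 \<le> l2_norm f"
  by (simp add: l2_norm_def)

text \<open>The estimate of \<open>h_fun\<close> is this one applied to \<open>exp_mult\<close> of
  the function. Cauchy-Schwarz is used for extended nonnegative integrals, so an upper bound for the
  integral of 1/S^2 is enough.\<close>

lemma cmod_LINT_restr_le:
  assumes a: "a \<in> space_A" and \<epsilon>: "0 < \<epsilon>1" "0 < \<epsilon>2"
  shows "cmod (LINT x|lborel. restr a x) \<le> 1 / (2 * pi * sqrt (\<epsilon>1 * \<epsilon>2)) * l2_norm (S_exp_Q (\<epsilon>1, \<epsilon>2) (restr a))"
proof -
  define S where "S = (\<lambda>(x1, x2). (exp (2 * pi * \<epsilon>1 * x1) + exp (- 2 * pi * \<epsilon>1 * x1)) *
       (exp (2 * pi * \<epsilon>2 * x2) + exp (- 2 * pi * \<epsilon>2 * x2)))"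
  have S_pos: "0 < S x" for x
    by (auto simp: S_def add_pos_pos split: prod.split)
  have [measurable]: "S \<in> borel_measurable borel"
    unfolding S_def case_prod_unfold by (intro borel_measurable_continuous_onI continuous_intros)
  have [measurable]: "restr a \<in> borel_measurable borel"
    using borel_measurable_integrable[OF integrable_restr[OF a]] by simp
  define N where "N = l2_norm (S_exp_Q (\<epsilon>1, \<epsilon>2) (restr a))"
  define K where "K = 1 / (2 * pi * sqrt (\<epsilon>1 * \<epsilon>2))"
  have cS: "cmod (S_exp_Q (\<epsilon>1, \<epsilon>2) (restr a) x) = S x * cmod (restr a x)" for x
  proof -
    have "S_exp_Q (\<epsilon>1, \<epsilon>2) (restr a) x = complex_of_real (S x) * restr a x"
      by (auto simp: S_exp_Q_def S_def split: prod.split)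
    then show ?thesis using S_pos[of x] by (simp add: norm_mult)
  qed
  \<comment> \<open>\<open>l2_norm\<close> is a Bochner integral, with value 0 on non-integrable
    functions; integrability is what lets \<open>N\<close> identify it with the extended
    integral.\<close>
  have int: "integrable lborel (\<lambda>x. (S x * cmod (restr a x))\<^sup>2)"
  proof -
    obtain b where b: "b \<in> space_A" "S_exp_Q (\<epsilon>1, \<epsilon>2) (restr a) = restr b"
      by (rule S_exp_Q_restr_space_A[OF a])
    show ?thesis
      using integrable_restr_sq[OF b(1)] unfolding cS[symmetric] b(2) .
  qed
  have N: "(\<integral>\<^sup>+ x. (ennreal (S x * cmod (restr a x)))\<^sup>2 \<partial>lborel) = ennreal (N\<^sup>2)"
    unfolding N_def l2_norm_def cS using S_pos
    by (simp add: ennreal_power less_imp_le nn_integral_eq_integral[OF int])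
  have inv_le: "(ennreal (1 / S x))\<^sup>2 \<le> (case x of (x1, x2) \<Rightarrow> ennreal (exp (- (4 * pi * (\<epsilon>1 * \<bar>x1\<bar> + \<epsilon>2 * \<bar>x2\<bar>)))))" for x
  proof -
    obtain x1 x2 where x: "x = (x1, x2)" by (cases x)
    \<comment> \<open>One of the two exponentials on the right equals the left side, according to
      the sign of u.\<close>
    have ge: "exp (2 * pi * (\<epsilon> * \<bar>u\<bar>)) \<le> exp (2 * pi * \<epsilon> * u) + exp (- 2 * pi * \<epsilon> * u)" for \<epsilon> u :: real
      by (cases "0 \<le> u") (auto simp: abs_if mult.assoc)
    have "exp (2 * pi * (\<epsilon>1 * \<bar>x1\<bar>)) * exp (2 * pi * (\<epsilon>2 * \<bar>x2\<bar>)) \<le> S x"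
      unfolding S_def x prod.case by (intro mult_mono ge) (auto intro: add_nonneg_nonneg)
    then have "1 / S x \<le> 1 / (exp (2 * pi * (\<epsilon>1 * \<bar>x1\<bar>)) * exp (2 * pi * (\<epsilon>2 * \<bar>x2\<bar>)))"
      by (intro divide_left_mono mult_pos_pos S_pos) auto
    also have "\<dots> = exp (- (2 * pi * (\<epsilon>1 * \<bar>x1\<bar> + \<epsilon>2 * \<bar>x2\<bar>)))"
      by (simp add: inverse_eq_divide[symmetric] exp_minus[symmetric] exp_add[symmetric] algebra_simps)
    finally have "(1 / S x)\<^sup>2 \<le> (exp (- (2 * pi * (\<epsilon>1 * \<bar>x1\<bar> + \<epsilon>2 * \<bar>x2\<bar>))))\<^sup>2"
      using S_pos[of x] by (intro power_mono) auto
    also have "\<dots> = exp (- (4 * pi * (\<epsilon>1 * \<bar>x1\<bar> + \<epsilon>2 * \<bar>x2\<bar>)))"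
      by (simp add: exp_double[symmetric] algebra_simps)
    finally show ?thesis
      using S_pos[of x] by (simp add: x ennreal_power less_imp_le ennreal_leI)
  qed
  have KK: "1 / (2 * pi * \<epsilon>1) * (1 / (2 * pi * \<epsilon>2)) = K\<^sup>2"
    using \<epsilon> by (simp add: K_def power_divide power_mult_distrib power2_eq_square)
  have "(\<integral>\<^sup>+ x. (ennreal (1 / S x))\<^sup>2 \<partial>lborel) \<le>
     (\<integral>\<^sup>+ (x1, x2). ennreal (exp (- (4 * pi * (\<epsilon>1 * \<bar>x1\<bar> + \<epsilon>2 * \<bar>x2\<bar>)))) \<partial>lborel)"
    by (intro nn_integral_mono inv_le)
  also have "\<dots> \<le> ennreal (K\<^sup>2)"
    using nn_integral_exp_neg_abs2[OF \<epsilon>] unfolding KK .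
  finally have inv_int: "(\<integral>\<^sup>+ x. (ennreal (1 / S x))\<^sup>2 \<partial>lborel) \<le> ennreal (K\<^sup>2)" .
  have "ennreal ((cmod (LINT x|lborel. restr a x))\<^sup>2) = (ennreal (cmod (LINT x|lborel. restr a x)))\<^sup>2"
    by (simp add: ennreal_power)
  also have "\<dots> \<le> (\<integral>\<^sup>+ x. ennreal (cmod (restr a x)) \<partial>lborel)\<^sup>2"
    by (intro power_mono integral_norm_bound_ennreal integrable_restr a) simp
  also have "(\<integral>\<^sup>+ x. ennreal (cmod (restr a x)) \<partial>lborel) =
      (\<integral>\<^sup>+ x. ennreal (S x * cmod (restr a x)) * ennreal (1 / S x) \<partial>lborel)"
    using S_pos by (intro nn_integral_cong) (simp add: ennreal_mult[symmetric] less_imp_le less_imp_neq[symmetric])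
  also have "\<dots>\<^sup>2 \<le> (\<integral>\<^sup>+ x. (ennreal (S x * cmod (restr a x)))\<^sup>2 \<partial>lborel) * (\<integral>\<^sup>+ x. (ennreal (1 / S x))\<^sup>2 \<partial>lborel)"
    by (rule Cauchy_Schwarz_nn_integral) measurable
  also have "\<dots> \<le> ennreal (N\<^sup>2) * ennreal (K\<^sup>2)"
    unfolding N by (intro mult_left_mono inv_int) simp
  also have "\<dots> = ennreal ((K * N)\<^sup>2)"
    by (simp add: ennreal_mult[symmetric] power_mult_distrib mult.commute)
  finally have "(cmod (LINT x|lborel. restr a x))\<^sup>2 \<le> (K * N)\<^sup>2"
    by simp
  moreover have "0 \<le> K * N"
    using \<epsilon> by (simp add: K_def N_def l2_norm_nonneg)
  ultimately have "cmod (LINT x|lborel. restr a x) \<le> K * N"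
    by (rule power2_le_imp_le)
  then show ?thesis unfolding K_def N_def .
qed

lemma cmod_h_fun_le:
  assumes "a \<in> space_A" "0 < \<epsilon>1" "0 < \<epsilon>2"
  shows "cmod (h_fun \<alpha> \<beta> (k1, k2) a) \<le> 1 / (2 * pi * sqrt (\<epsilon>1 * \<epsilon>2))
    * l2_norm (S_exp_Q (\<epsilon>1, \<epsilon>2) (exp_Q (alpha_k \<alpha> \<beta> k1, beta_k \<alpha> \<beta> k2) (restr a)))"
  unfolding h_fun_restr exp_Q_restr by (intro cmod_LINT_restr_le space_A_exp_mult assms)

text \<open>Continuity uses only the norms with d = 0, since \<open>h_fun\<close> sees only the
  restriction to the real plane.\<close>

lemma tau_norm_0: "tau_norm (c1, c2) (0, 0) a = l2_norm (restr (exp_mult (2 * pi * c1) (2 * pi * c2) a))"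
  by (simp add: tau_norm_def exp_P_def exp_Q_restr case_prod_unfold)

text \<open>For \<epsilon> = (1, 1) the weighted function is a sum of four terms, whose norms are
  the \<open>tau_norm\<close> values in the hypothesis. Pointwise the squared modulus of a sum of
  four is at most 4 times the sum of the squares, so the squared norm is at most 4 * 4 * r^2 = (4
  r)^2.\<close>

lemma l2_norm_S_exp_Q_less:
  assumes a: "a \<in> space_A" 
    and less: "\<And>s t. s \<in> {1, -1} \<Longrightarrow> t \<in> {1, -1} \<Longrightarrow> tau_norm (c1 + s, c2 + t) (0, 0) a < r"
  shows "l2_norm (S_exp_Q (1, 1) (exp_Q (c1, c2) (restr a))) \<le> 4 * r"
proof -
  define T where "T = {1, -1 :: real} \<times> {1, -1 :: real}"
  define g where "g = (\<lambda>(s, t). restr (exp_mult (2 * pi * (c1 + s)) (2 * pi * (c2 + t)) a))"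
  have int: "integrable lborel (\<lambda>x. (cmod (g p x))\<^sup>2)" for p
    unfolding g_def case_prod_unfold by (intro integrable_restr_sq space_A_exp_mult a)
  have r: "0 \<le> r"
    using le_less_trans[OF l2_norm_nonneg less[of 1 1, unfolded tau_norm_def]] by simp
  have le: "(LINT x|lborel. (cmod (g p x))\<^sup>2) \<le> r\<^sup>2" if "p \<in> T" for p
  proof -
    have "l2_norm (g p) < r"
      using less[of "fst p" "snd p"] that by (auto simp: tau_norm_0 g_def T_def)
    then have "(l2_norm (g p))\<^sup>2 \<le> r\<^sup>2"
      by (intro power_mono l2_norm_nonneg) auto
    then show ?thesis by (simp add: l2_norm_def)
  qed
  have sum: "S_exp_Q (1, 1) (exp_Q (c1, c2) (restr a)) x = (\<Sum>p\<in>T. g p x)" for x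
    unfolding exp_Q_restr S_exp_Q_restr exp_mult_exp_mult T_def
    by (simp add: sum.cartesian_product[symmetric] g_def restr_def case_prod_unfold algebra_simps)
  have bound: "(cmod (S_exp_Q (1, 1) (exp_Q (c1, c2) (restr a)) x))\<^sup>2 \<le> 4 * (\<Sum>p\<in>T. (cmod (g p x))\<^sup>2)" for x
  proof -
    have "(cmod (\<Sum>p\<in>T. g p x))\<^sup>2 \<le> (\<Sum>p\<in>T. cmod (g p x))\<^sup>2"
      by (intro power_mono norm_sum) simp
    also have "\<dots> \<le> (\<Sum>p\<in>T. (1::real)) * (\<Sum>p\<in>T. (cmod (g p x))\<^sup>2)"
      using Cauchy_Schwarz_ineq_sum[of "\<lambda>_. 1" "\<lambda>p. cmod (g p x)" T] by simp
    finally show ?thesis unfolding sum by (simp add: T_def)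
  qed
  have "(LINT x|lborel. (cmod (S_exp_Q (1, 1) (exp_Q (c1, c2) (restr a)) x))\<^sup>2) \<le>
     (LINT x|lborel. 4 * (\<Sum>p\<in>T. (cmod (g p x))\<^sup>2))"
  proof (rule integral_mono)
    obtain b where b: "b \<in> space_A" "S_exp_Q (1, 1) (exp_Q (c1, c2) (restr a)) = restr b"
      unfolding exp_Q_restr by (rule S_exp_Q_restr_space_A[OF space_A_exp_mult[OF a]])
    show "integrable lborel (\<lambda>x. (cmod (S_exp_Q (1, 1) (exp_Q (c1, c2) (restr a)) x))\<^sup>2)"
      unfolding b(2) by (rule integrable_restr_sq[OF b(1)])
  qed (use int bound in auto)
  also have "\<dots> = 4 * (\<Sum>p\<in>T. LINT x|lborel. (cmod (g p x))\<^sup>2)"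
    using int by simp
  also have "\<dots> \<le> 4 * (\<Sum>p\<in>T. r\<^sup>2)"
    by (intro mult_left_mono sum_mono le) auto
  also have "\<dots> = (4 * r)\<^sup>2"
    by (simp add: T_def power2_eq_square)
  finally show ?thesis
    unfolding l2_norm_def using r by (simp add: real_le_lsqrt real_sqrt_le_iff' real_le_rsqrt)
qed

lemma continuous_map_tau_h_fun: "continuous_map tau euclidean (h_fun \<alpha> \<beta> (k1, k2))"
proof -
  have ball: "openin tau {b \<in> space_A. tau_norm c d (\<lambda>z. b z - a z) < r}" if "a \<in> space_A" "0 < r" for a c d r
    unfolding tau_def by (rule topology_generated_by_Basis) (use that in blast)
  have self: "tau_norm c d (\<lambda>z. a z - a z) = 0" for a c d
    by (simp add: tau_norm_def exp_P_def restr_def exp_Q_def l2_norm_def case_prod_unfold)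
  have topspace: "topspace tau = space_A"
    unfolding tau_def topology_generated_by_topspace
  proof (intro equalityI subsetI)
    fix a assume "a \<in> space_A"
    then show "a \<in> \<Union> {{b \<in> space_A. tau_norm c d (\<lambda>z. b z - a z) < r} |a c d r. a \<in> space_A \<and> 0 < r}"
      using self[of "(0, 0)" "(0, 0)" a]
      by (intro UnionI[of "{b \<in> space_A. tau_norm (0, 0) (0, 0) (\<lambda>z. b z - a z) < 1}"] CollectI exI conjI refl) auto
  qed auto
  show ?thesis
    unfolding continuous_map_def topspace
  proof (intro conjI allI impI)
    fix U :: "complex set" assume "openin euclidean U"
    then have U: "open U" by simp
    show "openin tau {a \<in> space_A. h_fun \<alpha> \<beta> (k1, k2) a \<in> U}"
    proof (subst openin_subopen, intro ballI)
      fix a assume "a \<in> {a \<in> space_A. h_fun \<alpha> \<beta> (k1, k2) a \<in> U}"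
      then have a: "a \<in> space_A" and "h_fun \<alpha> \<beta> (k1, k2) a \<in> U" by auto
      then obtain e where e: "0 < e" "\<And>w. dist w (h_fun \<alpha> \<beta> (k1, k2) a) < e \<Longrightarrow> w \<in> U"
        using U unfolding open_dist by blast
      \<comment> \<open>Four subbasic balls centred at \<open>a\<close>, one for each sign pattern;
        the radius e / 4 makes the bound of \<open>l2_norm_S_exp_Q_less\<close> equal to e.\<close>
      define V where "V = (\<Inter>p\<in>{1, -1} \<times> {1, -1}. {b \<in> space_A.
        tau_norm (alpha_k \<alpha> \<beta> k1 + fst p, beta_k \<alpha> \<beta> k2 + snd p) (0, 0) (\<lambda>z. b z - a z) < e / 4})"
      have "openin tau V"
        unfolding V_def by (intro openin_Inter) (use ball[OF a, of "e / 4"] e(1) in auto)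
      moreover have "a \<in> V"
        unfolding V_def using a e(1) self by auto
      moreover have "h_fun \<alpha> \<beta> (k1, k2) b \<in> U" and b: "b \<in> space_A" if "b \<in> V" for b
      proof -
        show b: "b \<in> space_A" using that by (auto simp: V_def)
        define w where "w = (\<lambda>z. 1 * b z + (- 1) * a z)"
        have w: "w \<in> space_A" unfolding w_def by (intro space_A_lin a b)
        have "l2_norm (S_exp_Q (1, 1) (exp_Q (alpha_k \<alpha> \<beta> k1, beta_k \<alpha> \<beta> k2) (restr w))) \<le> 4 * (e / 4)"
          by (rule l2_norm_S_exp_Q_less[OF w]) (use that in \<open>auto simp: V_def w_def\<close>)
        then have "1 / (2 * pi) * l2_norm (S_exp_Q (1, 1) (exp_Q (alpha_k \<alpha> \<beta> k1, beta_k \<alpha> \<beta> k2) (restr w))) \<le> 1 / (2 * pi) * e"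
          by (intro mult_left_mono) auto
        \<comment> \<open>The constant 1 / (2 pi) from \<epsilon> = (1, 1) is below 1, which
          restores strictness.\<close>
        also have "\<dots> < 1 * e"
          using e(1) pi_gt3 by (intro mult_strict_right_mono) (auto simp: field_simps)
        finally have "cmod (h_fun \<alpha> \<beta> (k1, k2) w) < e"
          using cmod_h_fun_le[OF w, of 1 1 \<alpha> \<beta> k1 k2] by simp
        moreover have "h_fun \<alpha> \<beta> (k1, k2) w = h_fun \<alpha> \<beta> (k1, k2) b - h_fun \<alpha> \<beta> (k1, k2) a"
          unfolding w_def h_fun_lin[OF b a] by simp
        ultimately show "h_fun \<alpha> \<beta> (k1, k2) b \<in> U"
          by (intro e(2)) (simp add: dist_norm)
      qed
      ultimately show "\<exists>V. openin tau V \<and> a \<in> V \<and> V \<subseteq> {a \<in> space_A. h_fun \<alpha> \<beta> (k1, k2) a \<in> U}"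
        by blast
    qed
  qed auto
qed

theorem proposition22:
  fixes \<alpha> \<beta> \<gamma> :: real and k1 k2 :: int
  assumes "\<alpha> * \<beta> = \<gamma>" and "qpow \<gamma> 1 \<noteq> 1" and "qpow \<gamma> 1 \<noteq> -1"
  shows
    "((\<forall>a\<in>space_A. integrable lborel (h_integrand \<alpha> \<beta> (k1, k2) a)) \<and>
      (\<forall>a\<in>space_A. \<forall>b\<in>space_A. \<forall>c d. h_fun \<alpha> \<beta> (k1, k2) (\<lambda>z. c * a z + d * b z)
         = c * h_fun \<alpha> \<beta> (k1, k2) a + d * h_fun \<alpha> \<beta> (k1, k2) b) \<and>
      (\<exists>!chi. chi \<in> extensional (carrier (Uq \<gamma>)) \<and> uq_character \<gamma> chi \<and> chi_values \<gamma> chi) \<and>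
      (\<forall>chi. uq_character \<gamma> chi \<and> chi_values \<gamma> chi \<longrightarrow>
         (\<forall>f\<in>carrier (Uq \<gamma>). \<forall>a\<in>space_A.
            h_fun \<alpha> \<beta> (k1, k2) (uq_act \<gamma> \<alpha> \<beta> f a) = chi f * h_fun \<alpha> \<beta> (k1, k2) a)))
   \<and> (\<forall>(s :: real) (t :: real). \<forall>a\<in>space_A.
        h_fun \<alpha> \<beta> (k1, k2)
          (\<lambda>(z1, z2). a (z1 + complex_of_real (\<beta> * s), z2 + complex_of_real (\<alpha> * t)))
        = complex_of_real (exp (- 2 * pi * \<gamma> * (s + t) - 4 * pi * (k1 * s + k2 * t)))
          * h_fun \<alpha> \<beta> (k1, k2) a)
   \<and> (continuous_map tau euclidean (h_fun \<alpha> \<beta> (k1, k2)) \<and>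
      (\<forall>\<epsilon>1>0. \<forall>\<epsilon>2>0. \<forall>a\<in>space_A.
         cmod (h_fun \<alpha> \<beta> (k1, k2) a)
         \<le> 1 / (2 * pi * sqrt (\<epsilon>1 * \<epsilon>2))
           * l2_norm (S_exp_Q (\<epsilon>1, \<epsilon>2) (exp_Q (alpha_k \<alpha> \<beta> k1, beta_k \<alpha> \<beta> k2) (restr a)))))"
proof -
  have nz: "\<alpha> \<noteq> 0" "\<beta> \<noteq> 0"
    using assms by (auto simp: qpow_def)
  show ?thesis
    by (intro conjI ballI allI impI; (elim conjE)?)
      (rule integrable_h_integrand h_fun_lin ex1_uq_character h_fun_uq_act[OF assms]
        h_fun_real_shift[OF assms(1) nz] continuous_map_tau_h_fun cmod_h_fun_le; assumption)+
qed

end
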